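(* Let $d\in\mathbb{N}$, let $W\subset\mathbb{R}^d$ be a non-empty bounded open set and let $\Phi_1,\Phi_2,\ldots$ be independent and identically distributed point processes on $\mathbb{R}^d$ observed in $W$, with well-defined intensity function $\lambda$ and pair correlation function $g$. Suppose that $g:W\times W\to\mathbb{R}$ is bounded and that $\lambda:W\to(0,\infty)$ is twice continuously differentiable with second order partial derivatives $\lambda_{ij}=D_{ij}\lambda$, $i,j=1,\dots,d$, that are Hölder continuous with index $\alpha>0$ on $W$, that is, there exists $C>0$ such that for all $i,j=1,\dots,d$, \[ |\lambda_{ij}(x)-\lambda_{ij}(y)|\le C\|x-y\|^\alpha,\qquad x,y\in W. \] Let $\gamma\ge 0$ and let $(h_n)_{n\in\mathbb{N}}$ be a sequence of positive bandwidths with $h_n\to0$ and $nh_n^d\to\infty$ as $n\to\infty$. For $x_0\in W$ consider the estimator \[ \widehat{\lambda(x_0)}=\frac{1}{n h_n^d}\sum_{i=1}^n\sum_{y\in\Phi_i\cap W}\kappa^\gamma\Big(\frac{x_0-y}{h_n}\Big), \] where $\kappa^\gamma$ is the Beta kernel. Then, for $x_0\in W$, as $n\to\infty$, 1. $\displaystyle \mathrm{bias}\,\widehat{\lambda(x_0)}=h_n^2\,\frac{\sum_{i=1}^d\lambda_{ii}(x_0)}{2(d+2\gamma+2)}+O(h_n^{2+\alpha})$; 2. $\displaystyle \mathrm{Var}\,\widehat{\lambda(x_0)}=\frac{\lambda(x_0)\,Q(d,\gamma)}{nh_n^d}+O\Big(\frac{1}{nh_n^{d-1}}\Big)$.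
   Context: Point processes: the factorial moment measures of $\Phi_1$ of first and second order exist (as locally finite measures) and, on $W$ and $W\times W$ respectively, are absolutely continuous with respect to Lebesgue measure with densities $\lambda$ (the intensity function) and $\rho^{(2)}$ (the second order product density). That is, $\mathbb{E}\sum_{y\in\Phi_1\cap W}f(y)=\int_W f\lambda\,du$ and $\mathbb{E}\sum_{y\ne z\in\Phi_1\cap W}f(y,z)=\int_{W^2}f\rho^{(2)}\,du\,dv$ for non-negative measurable $f$. The pair correlation function is $g(u,v)=\rho^{(2)}(u,v)/(\lambda(u)\lambda(v))$ for $u,v\in W$. Beta kernel: for $\gamma\ge0$, $\kappa^\gamma(x)=c(d,\gamma)^{-1}(1-x^Tx)^\gamma\,1\{x\in b(0,1)\}$, $x\in\mathbb{R}^d$, where $b(0,1)$ is the closed unit ball of $\mathbb{R}^d$ centred at the origin and $c(d,\gamma)=\int_{b(0,1)}(1-x^Tx)^\gamma dx=\pi^{d/2}\Gamma(\gamma+1)/\Gamma(d/2+\gamma+1)$. Constant: $Q(d,\gamma)=\int_{\mathbb{R}^d}\kappa^\gamma(x)^2dx=c(d,2\gamma)/c(d,\gamma)^2$. The bias is $\mathrm{bias}\,\widehat{\lambda(x_0)}=\mathbb{E}\,\widehat{\lambda(x_0)}-\lambda(x_0)$. $D_i$, $D_{ij}$ denote first and second order partial derivatives. *)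

theory Defs
  imports "HOL-Probability.Probability"
begin

text \<open>
  A point configuration is given by its multiplicity function, so points need not be distinct;
  simple configurations are those with values in 0 and 1. Sums over the points of a configuration
  respect multiplicity.
\<close>

definition locally_finite :: "('a::euclidean_space \<Rightarrow> nat) \<Rightarrow> bool" where
  "locally_finite m \<longleftrightarrow> (\<forall>B. bounded B \<longrightarrow> finite {y \<in> B. m y \<noteq> 0})"

text \<open>
  The sum of \<open>f y\<close> over the points \<open>y\<close> of the configuration lying in \<open>B\<close>. It is only used for bounded
  \<open>B\<close>, where the index set is finite for every locally finite configuration.
\<close>

definition point_sum :: "('a \<Rightarrow> nat) \<Rightarrow> 'a set \<Rightarrow> ('a \<Rightarrow> 'b) \<Rightarrow> 'b::comm_semiring_1" where
  "point_sum m B f = (\<Sum>y\<in>{y \<in> B. m y \<noteq> 0}. of_nat (m y) * f y)"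

text \<open>
  The sum of \<open>f (y, z)\<close> over ordered pairs of different points of the configuration lying in \<open>B\<close>. Two
  coincident points count as different, which gives the factor \<open>m y * (m y - 1)\<close> on the diagonal (zero
  for simple configurations).
\<close>

definition point_pair_sum :: "('a \<Rightarrow> nat) \<Rightarrow> 'a set \<Rightarrow> ('a \<times> 'a \<Rightarrow> 'b) \<Rightarrow> 'b::comm_semiring_1" where
  "point_pair_sum m B f =
     (\<Sum>y\<in>{y \<in> B. m y \<noteq> 0}. \<Sum>z\<in>{z \<in> B. m z \<noteq> 0}.
        of_nat (m y * (if y = z then m z - 1 else m z)) * f (y, z))"

definition config_space :: "('a::euclidean_space \<Rightarrow> nat) measure" where
  "config_space = sigma {m. locally_finite m}
     {{m. locally_finite m \<and> point_sum m B (\<lambda>_. 1) = (k::nat)} | B k. B \<in> sets borel \<and> bounded B}"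

definition point_process :: "'w measure \<Rightarrow> ('w \<Rightarrow> 'a::euclidean_space \<Rightarrow> nat) \<Rightarrow> bool" where
  "point_process M X \<longleftrightarrow> X \<in> measurable M config_space"

definition iid_point_processes ::
  "'w measure \<Rightarrow> (nat \<Rightarrow> 'w \<Rightarrow> 'a::euclidean_space \<Rightarrow> nat) \<Rightarrow> nat set \<Rightarrow> bool" where
  "iid_point_processes M \<Phi> I \<longleftrightarrow>
     (\<forall>i\<in>I. point_process M (\<Phi> i)) \<and>
     prob_space.indep_vars M (\<lambda>_. config_space) \<Phi> I \<and>
     (\<forall>i\<in>I. \<forall>j\<in>I. distr M config_space (\<Phi> i) = distr M config_space (\<Phi> j))"

text \<open>
  Every bounded subset of the product space lies in some \<open>B \<times> B\<close> with \<open>B\<close> bounded, so products suffice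
  to express local finiteness of the second order factorial moment measure.
\<close>

definition locally_finite_factorial_moments ::
  "'w measure \<Rightarrow> ('w \<Rightarrow> 'a::euclidean_space \<Rightarrow> nat) \<Rightarrow> bool" where
  "locally_finite_factorial_moments M X \<longleftrightarrow>
     (\<forall>B\<in>sets borel. bounded B \<longrightarrow>
        (\<integral>\<^sup>+ \<omega>. point_sum (X \<omega>) B (\<lambda>_. 1) \<partial>M) < \<infinity> \<and>
        (\<integral>\<^sup>+ \<omega>. point_pair_sum (X \<omega>) B (\<lambda>_. 1) \<partial>M) < \<infinity>)"

definition intensity_on ::
  "'w measure \<Rightarrow> ('w \<Rightarrow> 'a::euclidean_space \<Rightarrow> nat) \<Rightarrow> 'a set \<Rightarrow> ('a \<Rightarrow> real) \<Rightarrow> bool" where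
  "intensity_on M X W lam \<longleftrightarrow>
     lam \<in> borel_measurable (restrict_space borel W) \<and> (\<forall>u\<in>W. 0 \<le> lam u) \<and>
     (\<forall>f::'a \<Rightarrow> ennreal. f \<in> borel_measurable borel \<longrightarrow>
        (\<integral>\<^sup>+ \<omega>. point_sum (X \<omega>) W f \<partial>M) = (\<integral>\<^sup>+ u\<in>W. f u * ennreal (lam u) \<partial>lborel))"

definition product_density_on ::
  "'w measure \<Rightarrow> ('w \<Rightarrow> 'a::euclidean_space \<Rightarrow> nat) \<Rightarrow> 'a set \<Rightarrow> ('a \<times> 'a \<Rightarrow> real) \<Rightarrow> bool" where
  "product_density_on M X W rho \<longleftrightarrow>
     rho \<in> borel_measurable (restrict_space borel (W \<times> W)) \<and> (\<forall>p\<in>W \<times> W. 0 \<le> rho p) \<and>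
     (\<forall>f::'a \<times> 'a \<Rightarrow> ennreal. f \<in> borel_measurable borel \<longrightarrow>
        (\<integral>\<^sup>+ \<omega>. point_pair_sum (X \<omega>) W f \<partial>M) =
        (\<integral>\<^sup>+ p\<in>W \<times> W. f p * ennreal (rho p) \<partial>lborel))"

definition pair_correlation_on ::
  "'w measure \<Rightarrow> ('w \<Rightarrow> 'a::euclidean_space \<Rightarrow> nat) \<Rightarrow> 'a set \<Rightarrow> ('a \<Rightarrow> real) \<Rightarrow> ('a \<times> 'a \<Rightarrow> real) \<Rightarrow> bool"
  where
  "pair_correlation_on M X W lam g \<longleftrightarrow>
     (\<exists>rho. product_density_on M X W rho \<and>
        (\<forall>u\<in>W. \<forall>v\<in>W. g (u, v) = rho (u, v) / (lam u * lam v)))"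

definition partial :: "'d::finite \<Rightarrow> (real^'d \<Rightarrow> real) \<Rightarrow> real^'d \<Rightarrow> real" where
  "partial i f x = deriv (\<lambda>t. f (x + t *\<^sub>R axis i 1)) 0"

definition C1_on :: "(real^'d::finite) set \<Rightarrow> (real^'d \<Rightarrow> real) \<Rightarrow> bool" where
  "C1_on W f \<longleftrightarrow>
     (\<forall>i. (\<forall>x\<in>W. (\<lambda>t. f (x + t *\<^sub>R axis i 1)) field_differentiable (at 0)) \<and>
          continuous_on W (partial i f))"

definition C2_on :: "(real^'d::finite) set \<Rightarrow> (real^'d \<Rightarrow> real) \<Rightarrow> bool" where
  "C2_on W f \<longleftrightarrow> C1_on W f \<and> (\<forall>i. C1_on W (partial i f))"

text \<open>
  Since \<open>0 powr 0 = 0\<close> in the library, the case \<open>\<gamma> = 0\<close> is treated separately; it is the indicator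
  function of the closed unit ball.
\<close>

definition beta_profile :: "real \<Rightarrow> real^'d::finite \<Rightarrow> real" where
  "beta_profile \<gamma> x =
     (if \<gamma> = 0 then 1 else (1 - x \<bullet> x) powr \<gamma>) * indicator (cball 0 1) x"

definition beta_const :: "'d::finite itself \<Rightarrow> real \<Rightarrow> real" where
  "beta_const _ \<gamma> = (\<integral>x. beta_profile \<gamma> (x :: real^'d) \<partial>lborel)"

definition beta_kernel :: "real \<Rightarrow> real^'d::finite \<Rightarrow> real" where
  "beta_kernel \<gamma> x = beta_profile \<gamma> x / beta_const TYPE('d) \<gamma>"

definition beta_Q :: "'d::finite itself \<Rightarrow> real \<Rightarrow> real" where
  "beta_Q _ \<gamma> = (\<integral>x. (beta_kernel \<gamma> (x :: real^'d))\<^sup>2 \<partial>lborel)"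

definition intensity_estimator ::
  "(nat \<Rightarrow> 'w \<Rightarrow> real^'d::finite \<Rightarrow> nat) \<Rightarrow> (real^'d) set \<Rightarrow> real \<Rightarrow> (nat \<Rightarrow> real) \<Rightarrow> real^'d
     \<Rightarrow> nat \<Rightarrow> 'w \<Rightarrow> real" where
  "intensity_estimator \<Phi> W \<gamma> h x0 n \<omega> =
     1 / (real n * h n ^ CARD('d)) *
     (\<Sum>i=1..n. point_sum (\<Phi> i \<omega>) W (\<lambda>y. beta_kernel \<gamma> ((1 / h n) *\<^sub>R (x0 - y))))"

end

theory Submission imports Defs begin

text \<open>
  Write \<open>k\<close> for the Beta kernel and \<open>t\<close> for the bandwidth. The estimator is an average of \<open>n\<close>
  independent copies of the random variable \<open>t\<^sup>-\<^sup>d S\<close>, where \<open>S\<close> is the sum of \<open>f y = k ((x0 - y) / t)\<close>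
  over the points of one process in \<open>W\<close>. Everything therefore follows from the mean and the variance of
  \<open>S\<close>.

  Moments of \<open>S\<close>. The mean is \<open>\<integral>\<^sub>W f \<lambda>\<close>. The square \<open>S\<^sup>2\<close> splits into the point sum of \<open>f\<^sup>2\<close> and
  the sum of \<open>f y f z\<close> over pairs of different points, so its mean is \<open>\<integral>\<^sub>W f\<^sup>2 \<lambda>\<close> plus a pair term.
  Since \<open>g\<close> is bounded, the product density is at most a multiple of \<open>\<lambda>(u) \<lambda>(v)\<close>, and the pair
  term is at most a multiple of the squared mean. Hence the variance of \<open>S\<close> equals \<open>\<integral>\<^sub>W f\<^sup>2 \<lambda>\<close> up to a
  multiple of \<open>(\<integral>\<^sub>W f \<lambda>)\<^sup>2\<close> (\<open>point_sum_moments\<close>, \<open>iid_point_sum_moments\<close>).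

  Change of variables. The support of \<open>k\<close> is the unit ball, so for small \<open>t\<close> only \<open>\<lambda>\<close> on a ball around
  \<open>x0\<close> inside \<open>W\<close> matters. Substituting \<open>y = x0 - t u\<close> gives \<open>t\<^sup>d \<integral> k(u) \<lambda>(x0 - t u) du\<close> for the mean
  and \<open>t\<^sup>d \<integral> k(u)\<^sup>2 \<lambda>(x0 - t u) du\<close> for the main part of the variance; the squared mean is of order
  \<open>t\<^sup>2\<^sup>d\<close>, which after division by \<open>n t\<^sup>2\<^sup>d\<close> contributes only \<open>O(1/n)\<close>.

  Bias. Expand \<open>\<lambda>(x0 - t u)\<close> to second order; the Hoelder condition bounds the remainder by a multiple
  of \<open>t\<close> to the power \<open>2 + \<alpha>\<close> (\<open>C2_on_Taylor\<close>). The kernel has total mass \<open>1\<close>, vanishing first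
  moments, and second moments \<open>\<integral> u\<^sub>i u\<^sub>j k = \<delta>\<^sub>i\<^sub>j / (d + 2 \<gamma> + 2)\<close> (\<open>beta_kernel_second_moment\<close>), so
  exactly the Laplacian of \<open>\<lambda>\<close> survives. Both moment identities come from the fact that a directional
  derivative of a compactly supported Lipschitz function integrates to zero
  (\<open>integral_directional_derivative_eq_0\<close>): this compares the moments with the mass of the kernel
  without evaluating either.

  Variance. For the factor \<open>\<integral> k\<^sup>2 \<lambda>(x0 - t u)\<close> the Lipschitz property of \<open>\<lambda>\<close> near \<open>x0\<close> gives
  \<open>\<lambda>(x0) Q\<close> with error \<open>O(t)\<close>, and \<open>O(t) / (n t\<^sup>d)\<close> is the claimed order, which also dominates \<open>O(1/n)\<close>.
\<close>

section \<open>First and second moments of sums over points\<close>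

lemma space_config_space: "space config_space = {m. locally_finite m}"
  unfolding config_space_def by (rule space_measure_of) auto

lemma finite_points: "locally_finite m \<Longrightarrow> bounded B \<Longrightarrow> finite {y \<in> B. m y \<noteq> 0}"
  by (simp add: locally_finite_def)

lemma measurable_count_points:
  assumes "B \<in> sets borel" "bounded B"
  shows "(\<lambda>m. point_sum m B (\<lambda>_. 1) :: nat) \<in> measurable config_space (count_space UNIV)"
  unfolding measurable_count_space_eq_countable[OF countableI_type]
proof (intro conjI ballI)
  fix k :: nat
  have "{m. locally_finite m \<and> point_sum m B (\<lambda>_. 1) = k} \<in> sets config_space"
    unfolding config_space_def using assms
    by (subst sets_measure_of) (auto intro!: sigma_sets.Basic)
  also have "{m. locally_finite m \<and> point_sum m B (\<lambda>_. 1) = k} =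
      (\<lambda>m. point_sum m B (\<lambda>_. 1)) -` {k} \<inter> space config_space"
    by (auto simp: space_config_space)
  finally show "(\<lambda>m. point_sum m B (\<lambda>_. 1)) -` {k} \<inter> space config_space \<in> sets config_space" .
qed auto

lemma point_sum_indicator:
  assumes "finite {y \<in> W. m y \<noteq> 0}"
  shows "point_sum m W (indicator A) = (of_nat (point_sum m (W \<inter> A) (\<lambda>_. 1)) :: 'b::comm_semiring_1)"
proof -
  have "point_sum m W (indicator A) = (\<Sum>y\<in>{y \<in> W. m y \<noteq> 0}. if y \<in> A then of_nat (m y) else (0::'b))"
    unfolding point_sum_def by (intro sum.cong) auto
  also have "\<dots> = (\<Sum>y\<in>{y \<in> W. m y \<noteq> 0} \<inter> {y. y \<in> A}. of_nat (m y))"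
    using assms by (subst sum.If_cases) auto
  also have "{y \<in> W. m y \<noteq> 0} \<inter> {y. y \<in> A} = {y \<in> W \<inter> A. m y \<noteq> 0}" by auto
  finally show ?thesis by (simp add: point_sum_def)
qed

text \<open>
  The \<open>\<sigma>\<close>-algebra on configurations only makes counts in bounded Borel sets measurable. Point sums of
  indicators are such counts, and the general case follows by monotone approximation, which commutes
  with the finite sum over the points in the bounded set \<open>W\<close>.
\<close>

lemma borel_measurable_point_sum:
  fixes f :: "'a::euclidean_space \<Rightarrow> ennreal"
  assumes f: "f \<in> borel_measurable borel" and W: "W \<in> sets borel" "bounded W"
  shows "(\<lambda>m. point_sum m W f) \<in> borel_measurable config_space"
  using f
proof (induction rule: borel_measurable_induct)
  case (cong f g)
  then have "f = g" by auto
  then show ?case using cong by simp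
next
  case (set A)
  have "W \<inter> A \<in> sets borel" "bounded (W \<inter> A)" using W set by auto
  note [measurable] = measurable_count_points[OF this]
  have "(\<lambda>m. of_nat (point_sum m (W \<inter> A) (\<lambda>_. 1)) :: ennreal) \<in> borel_measurable config_space"
    by measurable
  moreover have "point_sum m W (indicator A) = (of_nat (point_sum m (W \<inter> A) (\<lambda>_. 1)) :: ennreal)"
    if "m \<in> space config_space" for m
    using that W(2) by (intro point_sum_indicator finite_points) (simp_all add: space_config_space)
  ultimately show ?case by (simp cong: measurable_cong)
next
  case (mult u c)
  have "point_sum m W (\<lambda>x. c * u x) = c * point_sum m W u" for m
    by (simp add: point_sum_def sum_distrib_left mult_ac)
  then show ?case using mult by simp
next
  case (add u v)
  have "point_sum m W (\<lambda>x. v x + u x) = point_sum m W v + point_sum m W u" for m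
    by (simp add: point_sum_def sum.distrib distrib_left)
  then show ?case using add by simp
next
  case (seq U)
  have eq: "point_sum m W (SUP i. U i) = (SUP i. point_sum m W (U i))" for m
  proof -
    have "point_sum m W (SUP i. U i) = (\<Sum>y\<in>{y \<in> W. m y \<noteq> 0}. SUP i. of_nat (m y) * U i y)"
      unfolding point_sum_def by (intro sum.cong refl) (simp add: SUP_mult_left_ennreal image_comp)
    also have "\<dots> = (SUP i. point_sum m W (U i))"
      unfolding point_sum_def using \<open>incseq U\<close>
      by (subst ennreal_SUP_sum[symmetric]) (auto simp: incseq_def le_fun_def intro!: mult_left_mono)
    finally show ?thesis .
  qed
  have "(\<lambda>m. SUP i. point_sum m W (U i)) \<in> borel_measurable config_space"
    using seq by (intro borel_measurable_SUP) auto
  then show ?case by (simp only: eq)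
qed

lemma ennreal_point_sum:
  assumes "\<And>y. 0 \<le> f y"
  shows "ennreal (point_sum m W f) = point_sum m W (\<lambda>y. ennreal (f y))"
  using assms unfolding point_sum_def
  by (subst sum_ennreal[symmetric]) (auto simp: ennreal_mult ennreal_of_nat_eq_real_of_nat)

lemma point_sum_nonneg: "(\<And>y. 0 \<le> f y) \<Longrightarrow> 0 \<le> (point_sum m W f :: real)"
  unfolding point_sum_def by (intro sum_nonneg) auto

lemma point_pair_sum_nonneg: "(\<And>y. 0 \<le> f y) \<Longrightarrow> 0 \<le> (point_pair_sum m W f :: real)"
  unfolding point_pair_sum_def by (intro sum_nonneg mult_nonneg_nonneg) auto

lemma ennreal_point_pair_sum:
  assumes "\<And>y. 0 \<le> f y"
  shows "ennreal (point_pair_sum m W f) = point_pair_sum m W (\<lambda>p. ennreal (f p))"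
  using assms unfolding point_pair_sum_def
  by (simp only: sum_ennreal[symmetric] sum_nonneg of_nat_0_le_iff zero_le_mult_iff
      ennreal_mult ennreal_of_nat_eq_real_of_nat simp_thms)

lemma borel_measurable_point_sum_real:
  fixes f :: "'a::euclidean_space \<Rightarrow> real"
  assumes f: "f \<in> borel_measurable borel" "\<And>y. 0 \<le> f y" and W: "W \<in> sets borel" "bounded W"
  shows "(\<lambda>m. point_sum m W f) \<in> borel_measurable config_space"
proof -
  have "(\<lambda>m. enn2real (point_sum m W (\<lambda>y. ennreal (f y)))) \<in> borel_measurable config_space"
    using f W by (intro borel_measurable_enn2real borel_measurable_point_sum) auto
  also have "(\<lambda>m. enn2real (point_sum m W (\<lambda>y. ennreal (f y)))) = (\<lambda>m. point_sum m W f)"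
    using f by (simp add: ennreal_point_sum[symmetric] point_sum_nonneg)
  finally show ?thesis .
qed

text \<open>
  A pair of coincident points with multiplicity \<open>m y\<close> contributes \<open>(m y)\<^sup>2 = m y + m y (m y - 1)\<close> to the square:
  the first term belongs to the point sum of \<open>f\<^sup>2\<close>, the second to the pairs of different points.
\<close>

lemma point_sum_square:
  fixes f :: "'a \<Rightarrow> 'b::comm_semiring_1"
  assumes "finite {y \<in> W. m y \<noteq> 0}"
  shows "(point_sum m W f)\<^sup>2 = point_sum m W (\<lambda>y. (f y)\<^sup>2) + point_pair_sum m W (\<lambda>p. f (fst p) * f (snd p))"
proof -
  let ?S = "{y \<in> W. m y \<noteq> 0}"
  have pair: "of_nat (m y) * f y * (of_nat (m z) * f z) =
      (if y = z then of_nat (m y) * (f y)\<^sup>2 else 0)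
      + of_nat (m y * (if y = z then m z - 1 else m z)) * (f y * f z)"
    if "y \<in> ?S" for y z
  proof (cases "y = z")
    case True
    from that obtain k where k: "m y = Suc k" by (cases "m y") auto
    show ?thesis using True k by (simp add: power2_eq_square algebra_simps)
  qed (simp add: algebra_simps)
  have "(point_sum m W f)\<^sup>2 = (\<Sum>y\<in>?S. \<Sum>z\<in>?S. of_nat (m y) * f y * (of_nat (m z) * f z))"
    by (simp add: point_sum_def power2_eq_square sum_product)
  also have "\<dots> = (\<Sum>y\<in>?S. \<Sum>z\<in>?S. (if y = z then of_nat (m y) * (f y)\<^sup>2 else 0)
      + of_nat (m y * (if y = z then m z - 1 else m z)) * (f y * f z))"
    by (intro sum.cong refl pair)
  also have "\<dots> = (\<Sum>y\<in>?S. \<Sum>z\<in>?S. if y = z then of_nat (m y) * (f y)\<^sup>2 else 0)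
      + point_pair_sum m W (\<lambda>p. f (fst p) * f (snd p))"
    by (simp only: sum.distrib point_pair_sum_def fst_conv snd_conv)
  also have "(\<Sum>y\<in>?S. \<Sum>z\<in>?S. if y = z then of_nat (m y) * (f y)\<^sup>2 else 0) = point_sum m W (\<lambda>y. (f y)\<^sup>2)"
    unfolding point_sum_def using assms by (intro sum.cong) (auto simp: sum.delta)
  finally show ?thesis .
qed

text \<open>
  A product density dominated by \<open>K \<lambda>(u) \<lambda>(v)\<close> yields a pair integral that factorises by Tonelli's
  theorem.
\<close>

lemma nn_integral_pair_density_le:
  fixes f :: "'a::euclidean_space \<Rightarrow> real"
  assumes f[measurable]: "f \<in> borel_measurable borel" and f0: "\<And>y. 0 \<le> f y"
    and lam: "lam \<in> borel_measurable (restrict_space borel W)" "\<And>u. u \<in> W \<Longrightarrow> 0 \<le> lam u"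
    and W[measurable]: "W \<in> sets borel" 
    and rho: "\<And>u v. u \<in> W \<Longrightarrow> v \<in> W \<Longrightarrow> rho (u, v) \<le> K * (lam u * lam v)" and K: "K \<ge> 0"
  shows "(\<integral>\<^sup>+ p\<in>W \<times> W. ennreal (f (fst p) * f (snd p)) * ennreal (rho p) \<partial>lborel)
    \<le> ennreal K * (\<integral>\<^sup>+ u\<in>W. ennreal (f u * lam u) \<partial>lborel)\<^sup>2"
proof -
  define F where "F u = ennreal (f u * lam u) * indicator W u" for u
  have [measurable]: "F \<in> borel_measurable borel"
  proof -
    have "(\<lambda>u. lam u * indicator W u) \<in> borel_measurable borel"
      using lam(1) W by (subst (asm) borel_measurable_restrict_space_iff) (auto simp: mult.commute)
    then have "(\<lambda>u. ennreal (f u * (lam u * indicator W u))) \<in> borel_measurable borel" by measurable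
    also have "(\<lambda>u. ennreal (f u * (lam u * indicator W u))) = F"
      by (auto simp: F_def indicator_def)
    finally show ?thesis .
  qed
  have "(\<integral>\<^sup>+ p\<in>W \<times> W. ennreal (f (fst p) * f (snd p)) * ennreal (rho p) \<partial>lborel)
      \<le> (\<integral>\<^sup>+ p. ennreal K * (F (fst p) * F (snd p)) \<partial>(lborel \<Otimes>\<^sub>M lborel))"
    unfolding lborel_prod
  proof (rule nn_integral_mono)
    fix p :: "'a \<times> 'a"
    show "ennreal (f (fst p) * f (snd p)) * ennreal (rho p) * indicator (W \<times> W) p
        \<le> ennreal K * (F (fst p) * F (snd p))"
    proof (cases "p \<in> W \<times> W")
      case True
      then have p: "fst p \<in> W" "snd p \<in> W" by auto
      have "f (fst p) * f (snd p) * rho p \<le> f (fst p) * f (snd p) * (K * (lam (fst p) * lam (snd p)))"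
        using rho[OF p] f0 by (intro mult_left_mono) auto
      then have "ennreal (f (fst p) * f (snd p) * rho p)
          \<le> ennreal (K * ((f (fst p) * lam (fst p)) * (f (snd p) * lam (snd p))))"
        by (intro ennreal_leI) (simp add: mult_ac)
      also have "\<dots> = ennreal K * (F (fst p) * F (snd p))"
        using p f0 lam(2) K by (simp add: F_def ennreal_mult)
      finally show ?thesis using True f0 by (subst ennreal_mult'[symmetric]) auto
    qed simp
  qed
  also have "\<dots> = ennreal K * (\<integral>\<^sup>+ u. \<integral>\<^sup>+ v. F u * F v \<partial>lborel \<partial>lborel)"
    by (subst nn_integral_cmult) (auto simp: lborel.nn_integral_fst[symmetric])
  also have "\<dots> = ennreal K * (\<integral>\<^sup>+ u. F u \<partial>lborel)\<^sup>2"
    by (simp add: nn_integral_cmult nn_integral_multc power2_eq_square)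
  finally show ?thesis by (simp add: F_def)
qed

text \<open>
  The variance of a point sum is that of a Poisson process, \<open>b\<close>, up to a multiple of the squared mean.
\<close>

lemma point_sum_moments:
  fixes f :: "'a::euclidean_space \<Rightarrow> real"
  assumes M: "prob_space M" and X: "point_process M X"
    and W: "open W" "bounded W"
    and lam: "intensity_on M X W lam" and rho: "product_density_on M X W rho"
    and K: "K \<ge> 0" "\<And>u v. u \<in> W \<Longrightarrow> v \<in> W \<Longrightarrow> rho (u, v) \<le> K * (lam u * lam v)"
    and f: "f \<in> borel_measurable borel" "\<And>y. 0 \<le> f y"
    and a: "(\<integral>\<^sup>+ u\<in>W. ennreal (f u * lam u) \<partial>lborel) = ennreal a" "a \<ge> 0"
    and b: "(\<integral>\<^sup>+ u\<in>W. ennreal ((f u)\<^sup>2 * lam u) \<partial>lborel) = ennreal b" "b \<ge> 0"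
  shows "integrable M (\<lambda>\<omega>. point_sum (X \<omega>) W f)"
    and "integrable M (\<lambda>\<omega>. (point_sum (X \<omega>) W f)\<^sup>2)"
    and "prob_space.expectation M (\<lambda>\<omega>. point_sum (X \<omega>) W f) = a"
    and "\<bar>prob_space.variance M (\<lambda>\<omega>. point_sum (X \<omega>) W f) - b\<bar> \<le> (K + 1) * a\<^sup>2"
proof -
  interpret prob_space M by fact
  have Wb: "W \<in> sets borel" using W by simp
  have X_meas: "X \<in> measurable M config_space" using X by (simp add: point_process_def)
  define S where "S \<omega> = point_sum (X \<omega>) W f" for \<omega>
  define S2 where "S2 \<omega> = point_sum (X \<omega>) W (\<lambda>y. (f y)\<^sup>2)" for \<omega>
  define P where "P \<omega> = point_pair_sum (X \<omega>) W (\<lambda>p. f (fst p) * f (snd p))" for \<omega>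
  have S_eq: "S = (\<lambda>\<omega>. point_sum (X \<omega>) W f)" by (simp add: S_def fun_eq_iff)
  have f2: "(\<lambda>y. (f y)\<^sup>2) \<in> borel_measurable borel" using f by simp
  have S_meas[measurable]: "S \<in> borel_measurable M" "S2 \<in> borel_measurable M"
    using measurable_compose[OF X_meas borel_measurable_point_sum_real[OF f Wb W(2)]]
      measurable_compose[OF X_meas borel_measurable_point_sum_real[OF f2 _ Wb W(2)]]
    by (auto simp: S_def[abs_def] S2_def[abs_def])
  have S0: "S \<omega> \<ge> 0" "S2 \<omega> \<ge> 0" "P \<omega> \<ge> 0" for \<omega>
    using f(2) by (auto simp: S_def S2_def P_def intro!: point_sum_nonneg point_pair_sum_nonneg)
  have square: "(S \<omega>)\<^sup>2 = S2 \<omega> + P \<omega>" if "\<omega> \<in> space M" for \<omega>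
    unfolding S_def S2_def P_def using measurable_space[OF X_meas that] W(2)
    by (intro point_sum_square finite_points) (simp_all add: space_config_space)
  \<comment> \<open>Measurability of the pair sum comes for free from the decomposition of the square.\<close>
  have P_meas[measurable]: "P \<in> borel_measurable M"
  proof -
    have "(\<lambda>\<omega>. (S \<omega>)\<^sup>2 - S2 \<omega>) \<in> borel_measurable M" by measurable
    then show ?thesis by (rule measurable_cong[THEN iffD1, rotated]) (simp add: square)
  qed
  have lam0: "\<And>u. u \<in> W \<Longrightarrow> 0 \<le> lam u" and lam_meas: "lam \<in> borel_measurable (restrict_space borel W)"
    using lam by (auto simp: intensity_on_def)
  have campbell: "(\<integral>\<^sup>+ \<omega>. ennreal (point_sum (X \<omega>) W q) \<partial>M) = (\<integral>\<^sup>+ u\<in>W. ennreal (q u * lam u) \<partial>lborel)"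
    if "q \<in> borel_measurable borel" "\<And>y. 0 \<le> q y" for q
  proof -
    have "(\<integral>\<^sup>+ \<omega>. ennreal (point_sum (X \<omega>) W q) \<partial>M) = (\<integral>\<^sup>+ u\<in>W. ennreal (q u) * ennreal (lam u) \<partial>lborel)"
      using lam that by (simp add: intensity_on_def ennreal_point_sum)
    also have "\<dots> = (\<integral>\<^sup>+ u\<in>W. ennreal (q u * lam u) \<partial>lborel)"
      using that lam0 by (intro nn_integral_cong) (auto simp: indicator_def ennreal_mult)
    finally show ?thesis .
  qed
  have ES: "(\<integral>\<^sup>+ \<omega>. ennreal (S \<omega>) \<partial>M) = ennreal a"
    unfolding S_def using campbell[OF f] a by simp
  have ES2: "(\<integral>\<^sup>+ \<omega>. ennreal (S2 \<omega>) \<partial>M) = ennreal b"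
    unfolding S2_def using campbell[OF f2] b by simp
  have "(\<integral>\<^sup>+ \<omega>. ennreal (P \<omega>) \<partial>M) =
      (\<integral>\<^sup>+ p\<in>W \<times> W. ennreal (f (fst p) * f (snd p)) * ennreal (rho p) \<partial>lborel)"
  proof -
    have "(\<lambda>p::'a \<times> 'a. ennreal (f (fst p) * f (snd p))) \<in> borel_measurable (borel \<Otimes>\<^sub>M borel)"
      using f(1) by measurable
    then have "(\<lambda>p::'a \<times> 'a. ennreal (f (fst p) * f (snd p))) \<in> borel_measurable borel"
      by (simp only: borel_prod)
    then show ?thesis
      using rho f(2) unfolding P_def product_density_on_def by (simp add: ennreal_point_pair_sum)
  qed
  also have "\<dots> \<le> ennreal K * (ennreal a)\<^sup>2"
    using nn_integral_pair_density_le[OF f lam_meas lam0 Wb K(2) K(1)] a by simp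
  finally have EP_le: "(\<integral>\<^sup>+ \<omega>. ennreal (P \<omega>) \<partial>M) \<le> ennreal (K * a\<^sup>2)"
    using K a by (simp add: ennreal_mult ennreal_power)
  then have "(\<integral>\<^sup>+ \<omega>. ennreal (P \<omega>) \<partial>M) < top"
    using ennreal_less_top le_less_trans by blast
  then have int_P: "integrable M P" using S0 by (intro integrableI_nonneg) auto
  have EP: "expectation P \<le> K * a\<^sup>2" "expectation P \<ge> 0"
  proof -
    have "ennreal (expectation P) \<le> ennreal (K * a\<^sup>2)"
      using EP_le nn_integral_eq_integral[OF int_P] S0 by simp
    then show "expectation P \<le> K * a\<^sup>2" using K by (subst (asm) ennreal_le_iff) auto
  qed (simp add: S0)
  have S: "integrable M S" "expectation S = a"
    using ES S0 a by (auto intro!: integrableI_nonneg simp: integral_eq_nn_integral)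
  have int_S2: "integrable M S2" "expectation S2 = b"
    using ES2 S0 b by (auto intro!: integrableI_nonneg simp: integral_eq_nn_integral)
  have int_SS: "integrable M (\<lambda>\<omega>. (S \<omega>)\<^sup>2)"
    using Bochner_Integration.integrable_add[OF int_S2(1) int_P]
    by (subst Bochner_Integration.integrable_cong[OF refl square]) auto
  have "expectation (\<lambda>\<omega>. (S \<omega>)\<^sup>2) = expectation (\<lambda>\<omega>. S2 \<omega> + P \<omega>)"
    by (intro Bochner_Integration.integral_cong) (auto simp: square)
  also have "\<dots> = b + expectation P" using int_S2 int_P by simp
  finally have "expectation (\<lambda>\<omega>. (S \<omega>)\<^sup>2) = b + expectation P" .
  moreover have "variance S = expectation (\<lambda>\<omega>. (S \<omega>)\<^sup>2) - (expectation S)\<^sup>2"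
    by (rule variance_eq[OF S(1) int_SS])
  ultimately have "variance S - b = expectation P - a\<^sup>2"
    using S(2) by simp
  then have "\<bar>variance S - b\<bar> \<le> (K + 1) * a\<^sup>2"
    using EP K by (simp add: abs_le_iff algebra_simps) (smt (verit) zero_le_power2 mult_nonneg_nonneg)
  then show "integrable M (\<lambda>\<omega>. point_sum (X \<omega>) W f)"
    and "integrable M (\<lambda>\<omega>. (point_sum (X \<omega>) W f)\<^sup>2)"
    and "expectation (\<lambda>\<omega>. point_sum (X \<omega>) W f) = a"
    and "\<bar>variance (\<lambda>\<omega>. point_sum (X \<omega>) W f) - b\<bar> \<le> (K + 1) * a\<^sup>2"
    using S int_SS unfolding S_eq by blast+
qed

lemma product_density_le_of_bounded_pair_correlation:
  assumes pc: "pair_correlation_on M X W lam g" and g: "bounded (g ` (W \<times> W))"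
    and lam: "\<And>x. x \<in> W \<Longrightarrow> lam x > 0"
  obtains rho K where "product_density_on M X W rho" "K \<ge> 0"
    "\<And>u v. u \<in> W \<Longrightarrow> v \<in> W \<Longrightarrow> rho (u, v) \<le> K * (lam u * lam v)"
proof -
  obtain rho where rho: "product_density_on M X W rho"
    and eq: "\<And>u v. u \<in> W \<Longrightarrow> v \<in> W \<Longrightarrow> g (u, v) = rho (u, v) / (lam u * lam v)"
    using pc unfolding pair_correlation_on_def by blast
  obtain K where K: "\<And>p. p \<in> W \<times> W \<Longrightarrow> \<bar>g p\<bar> \<le> K"
    using g unfolding bounded_iff by auto
  show ?thesis
  proof (rule that[OF rho, of "\<bar>K\<bar>"])
    fix u v assume uv: "u \<in> W" "v \<in> W"
    have "g (u, v) \<le> \<bar>K\<bar>" using K[of "(u, v)"] uv by auto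
    moreover have "lam u * lam v > 0" using lam uv by simp
    ultimately show "rho (u, v) \<le> \<bar>K\<bar> * (lam u * lam v)" using eq[OF uv] by (simp add: pos_divide_le_eq)
  qed simp
qed

section \<open>Averages over independent copies\<close>

text \<open>
  After centring, the square of the sum expands into products of two factors, and independence
  annihilates the expectation of all mixed products.
\<close>

lemma (in prob_space) variance_sum_indep:
  fixes X :: "'i \<Rightarrow> 'a \<Rightarrow> real"
  assumes I: "finite I" and indep: "indep_vars (\<lambda>_. borel) X I"
    and int: "\<And>i. i \<in> I \<Longrightarrow> integrable M (X i)" "\<And>i. i \<in> I \<Longrightarrow> integrable M (\<lambda>\<omega>. (X i \<omega>)\<^sup>2)"
  shows "variance (\<lambda>\<omega>. \<Sum>i\<in>I. X i \<omega>) = (\<Sum>i\<in>I. variance (X i))"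
proof -
  define Y where "Y i \<omega> = X i \<omega> - expectation (X i)" for i \<omega>
  have int_Y: "integrable M (Y i)" "expectation (Y i) = 0" if "i \<in> I" for i
    using int[OF that] by (simp_all add: Y_def[abs_def] prob_space)
  have int_sq: "integrable M (\<lambda>\<omega>. (Y i \<omega>)\<^sup>2)" if "i \<in> I" for i
    using int[OF that] by (simp add: Y_def power2_diff)
  have indep_Y: "indep_vars (\<lambda>_. borel) Y I"
    unfolding Y_def[abs_def] by (rule indep_vars_compose2[OF indep]) auto
  have cross: "integrable M (\<lambda>\<omega>. Y i \<omega> * Y j \<omega>) \<and>
      expectation (\<lambda>\<omega>. Y i \<omega> * Y j \<omega>) = (if i = j then variance (X i) else 0)"
    if ij: "i \<in> I" "j \<in> I" for i j
  proof (cases "i = j")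
    case True
    then show ?thesis using int_sq[OF ij(1)] by (simp add: Y_def power2_eq_square)
  next
    case False
    have "indep_vars (\<lambda>_. borel) Y {i, j}" using ij by (intro indep_vars_subset[OF indep_Y]) auto
    from indep_vars_lebesgue_integral[OF _ this] indep_vars_integrable[OF _ this] False ij int_Y
    show ?thesis by auto
  qed
  have "expectation (\<lambda>\<omega>. \<Sum>i\<in>I. X i \<omega>) = (\<Sum>i\<in>I. expectation (X i))"
    using int by (intro Bochner_Integration.integral_sum) auto
  then have "variance (\<lambda>\<omega>. \<Sum>i\<in>I. X i \<omega>) = expectation (\<lambda>\<omega>. \<Sum>i\<in>I. \<Sum>j\<in>I. Y i \<omega> * Y j \<omega>)"
    by (simp add: Y_def power2_eq_square sum_product flip: sum_subtractf)
  also have "\<dots> = (\<Sum>i\<in>I. \<Sum>j\<in>I. expectation (\<lambda>\<omega>. Y i \<omega> * Y j \<omega>))"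
    using cross by (simp add: Bochner_Integration.integral_sum)
  also have "\<dots> = (\<Sum>i\<in>I. \<Sum>j\<in>I. if i = j then variance (X i) else 0)"
    using cross by (intro sum.cong) auto
  finally show ?thesis using I by (simp add: sum.delta)
qed

text \<open>
  The factor \<open>c\<close> stands for the normalisation of the estimator; the dominated pair term makes the error
  in the variance a multiple of the squared mean \<open>a\<^sup>2\<close>.
\<close>

lemma iid_point_sum_moments:
  fixes f :: "'a::euclidean_space \<Rightarrow> real" and n :: nat and c :: real
  assumes M: "prob_space M" and iid: "iid_point_processes M \<Phi> {1..}"
    and W: "open W" "bounded W"
    and lam: "intensity_on M (\<Phi> 1) W lam" and rho: "product_density_on M (\<Phi> 1) W rho"
    and K: "K \<ge> 0" "\<And>u v. u \<in> W \<Longrightarrow> v \<in> W \<Longrightarrow> rho (u, v) \<le> K * (lam u * lam v)"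
    and f: "f \<in> borel_measurable borel" "\<And>y. 0 \<le> f y"
    and a: "(\<integral>\<^sup>+ u\<in>W. ennreal (f u * lam u) \<partial>lborel) = ennreal a" "a \<ge> 0"
    and b: "(\<integral>\<^sup>+ u\<in>W. ennreal ((f u)\<^sup>2 * lam u) \<partial>lborel) = ennreal b" "b \<ge> 0"
  defines "T \<equiv> \<lambda>\<omega>. c * (\<Sum>i=1..n. point_sum (\<Phi> i \<omega>) W f)"
  shows "prob_space.expectation M T = c * (real n * a)"
    and "\<bar>prob_space.variance M T - c\<^sup>2 * (real n * b)\<bar> \<le> c\<^sup>2 * (real n * ((K + 1) * a\<^sup>2))"
proof -
  interpret prob_space M by fact
  note iid = iid[unfolded iid_point_processes_def, THEN conjunct1]
    iid[unfolded iid_point_processes_def, THEN conjunct2, THEN conjunct1]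
    iid[unfolded iid_point_processes_def, THEN conjunct2, THEN conjunct2]
  have pp: "point_process M (\<Phi> i)" if "i \<ge> 1" for i using iid(1) that by simp
  then have meas: "\<Phi> i \<in> measurable M config_space" if "i \<ge> 1" for i using that by (simp add: point_process_def)
  have ps_meas: "(\<lambda>m. point_sum m W f) \<in> borel_measurable config_space"
    using f W by (intro borel_measurable_point_sum_real) auto
  define P where "P \<omega> = point_sum (\<Phi> 1 \<omega>) W f" for \<omega>
  have P_eq: "P = (\<lambda>\<omega>. point_sum (\<Phi> 1 \<omega>) W f)" by (simp add: P_def fun_eq_iff)
  have mom: "integrable M P" "integrable M (\<lambda>\<omega>. (P \<omega>)\<^sup>2)" "expectation P = a"
      "\<bar>variance P - b\<bar> \<le> (K + 1) * a\<^sup>2"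
    unfolding P_eq using point_sum_moments[OF M pp[OF order_refl] W lam rho K(1) _ f a b] K(2)
    by blast+
  define S where "S i \<omega> = point_sum (\<Phi> i \<omega>) W f" for i \<omega>
  define v where "v = variance (S 1)"
  have same: "(integrable M (\<lambda>\<omega>. F (\<Phi> i \<omega>)) \<longleftrightarrow> integrable M (\<lambda>\<omega>. F (\<Phi> 1 \<omega>))) \<and>
      expectation (\<lambda>\<omega>. F (\<Phi> i \<omega>)) = expectation (\<lambda>\<omega>. F (\<Phi> 1 \<omega>))"
    if F: "F \<in> borel_measurable config_space" and i: "i \<ge> 1" for F :: "_ \<Rightarrow> real" and i
  proof -
    have d: "distr M config_space (\<Phi> i) = distr M config_space (\<Phi> 1)"
      using iid(3) i by (metis atLeast_iff order_refl)
    show ?thesis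
      unfolding integrable_distr_eq[OF meas[OF i] F, symmetric] integral_distr[OF meas[OF i] F, symmetric]
        integrable_distr_eq[OF meas[OF order_refl] F, symmetric]
        integral_distr[OF meas[OF order_refl] F, symmetric] d
      by (rule conjI[OF refl refl])
  qed
  have ps_sq_meas: "(\<lambda>m. (point_sum m W f)\<^sup>2) \<in> borel_measurable config_space"
    and ps_c_meas: "(\<lambda>m. (point_sum m W f - a)\<^sup>2) \<in> borel_measurable config_space"
    by (intro borel_measurable_power borel_measurable_diff ps_meas borel_measurable_const)+
  have S_eq: "S i = (\<lambda>\<omega>. point_sum (\<Phi> i \<omega>) W f)" for i by (simp add: S_def fun_eq_iff)
  have S: "integrable M (S i)" "integrable M (\<lambda>\<omega>. (S i \<omega>)\<^sup>2)" "expectation (S i) = a" "variance (S i) = v"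
    if "i \<ge> 1" for i
  proof -
    show 1: "integrable M (S i)" "integrable M (\<lambda>\<omega>. (S i \<omega>)\<^sup>2)" "expectation (S i) = a"
      unfolding S_eq using same[OF ps_meas that] same[OF ps_sq_meas that] mom(1-3) by (simp_all add: P_eq)
    have "expectation (S 1) = a" using mom(3) by (simp only: S_eq P_eq)
    then show "variance (S i) = v"
      unfolding v_def 1(3) using same[OF ps_c_meas that] by (simp add: S_eq)
  qed
  have v: "\<bar>v - b\<bar> \<le> (K + 1) * a\<^sup>2" using mom(4) by (simp only: v_def S_eq P_eq)
  have T: "T = (\<lambda>\<omega>. c * (\<Sum>i=1..n. S i \<omega>))" by (simp add: T_def S_def)
  have ET: "expectation T = c * (real n * a)"
    unfolding T using S by (simp add: Bochner_Integration.integral_sum)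
  then show "expectation T = c * (real n * a)" .
  have "indep_vars (\<lambda>_. borel) S {1..n}"
  proof -
    have "indep_vars (\<lambda>_. config_space) \<Phi> {1..n}"
      by (rule indep_vars_subset[OF iid(2)]) auto
    then show ?thesis unfolding S_def[abs_def]
      using ps_meas by (rule indep_vars_compose2)
  qed
  then have "variance (\<lambda>\<omega>. \<Sum>i=1..n. S i \<omega>) = (\<Sum>i=1..n. variance (S i))"
    using S by (intro variance_sum_indep) auto
  then have vs: "variance (\<lambda>\<omega>. \<Sum>i=1..n. S i \<omega>) = real n * v" using S by simp
  have "variance T = c\<^sup>2 * variance (\<lambda>\<omega>. \<Sum>i=1..n. S i \<omega>)"
    unfolding T by (simp add: power_mult_distrib flip: right_diff_distrib)
  then have "variance T - c\<^sup>2 * (real n * b) = c\<^sup>2 * (real n * (v - b))"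
    using vs by (simp add: right_diff_distrib)
  then show "\<bar>variance T - c\<^sup>2 * (real n * b)\<bar> \<le> c\<^sup>2 * (real n * ((K + 1) * a\<^sup>2))"
    using v by (simp add: abs_mult mult_left_mono)
qed

section \<open>Moments of the Beta kernel\<close>

lemma integrable_lborel_bounded_support:
  fixes f :: "'a::euclidean_space \<Rightarrow> real"
  assumes f: "f \<in> borel_measurable borel"
    and bound: "\<And>x. \<bar>f x\<bar> \<le> B" and supp: "\<And>x. norm x > R \<Longrightarrow> f x = 0"
  shows "integrable lborel f"
proof -
  have "integrable lborel (\<lambda>x. indicator (cball 0 R) x *\<^sub>R f x)"
    using f bound emeasure_bounded_finite[OF bounded_cball, of "0::'a" R]
    by (intro integrableI_bounded_set_indicator[where B = B]) (auto simp: less_top)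
  also have "(\<lambda>x. indicator (cball 0 R) x *\<^sub>R f x) = f"
    using supp by (auto simp: fun_eq_iff indicator_def not_le)
  finally show ?thesis .
qed

lemma lborel_integral_translate:
  fixes f :: "'a::euclidean_space \<Rightarrow> real"
  assumes "f \<in> borel_measurable borel"
  shows "(\<integral>x. f (x + a) \<partial>lborel) = (\<integral>x. f x \<partial>lborel)"
proof -
  have "(\<integral>x. f x \<partial>lborel) = (\<integral>x. f x \<partial>distr lborel borel ((+) a))"
    by (simp add: lborel_distr_plus)
  also have "\<dots> = (\<integral>x. f (a + x) \<partial>lborel)"
    using assms by (subst integral_distr) auto
  finally show ?thesis by (simp add: add.commute)
qed

text \<open>
  By translation invariance every difference quotient of \<open>F\<close> in direction \<open>e\<close> integrates to zero. The
  Lipschitz bound and the bounded support provide a dominating function for the passage to the limit,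
  and asking for the derivative only almost everywhere allows \<open>F\<close> to have kinks on a sphere.
\<close>

lemma integral_directional_derivative_eq_0:
  fixes F :: "'a::euclidean_space \<Rightarrow> real"
  assumes F[measurable]: "F \<in> borel_measurable borel" and F'[measurable]: "F' \<in> borel_measurable borel"
    and bound: "\<And>x. \<bar>F x\<bar> \<le> B" and supp: "\<And>x. norm x > R \<Longrightarrow> F x = 0"
    and lip: "\<And>x y. \<bar>F x - F y\<bar> \<le> L * norm (x - y)"
    and deriv: "AE x in lborel. ((\<lambda>t. F (x + t *\<^sub>R e)) has_real_derivative F' x) (at 0)"
  shows "(\<integral>x. F' x \<partial>lborel) = 0"
proof -
  define t :: "nat \<Rightarrow> real" where "t k = 1 / real (Suc k)" for k
  have t: "t \<longlonglongrightarrow> 0" unfolding t_def using LIMSEQ_inverse_real_of_nat by (simp add: inverse_eq_divide)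
  have t_pos: "t k > 0" "t k \<le> 1" for k by (auto simp: t_def)
  define q where "q k x = (F (x + t k *\<^sub>R e) - F x) / t k" for k x
  have [measurable]: "q k \<in> borel_measurable borel" for k unfolding q_def by measurable
  have int_F: "integrable lborel F" "integrable lborel (\<lambda>x. F (x + t k *\<^sub>R e))" for k
  proof -
    show "integrable lborel F" by (rule integrable_lborel_bounded_support[OF F bound supp])
    have "integrable (distr lborel borel ((+) (t k *\<^sub>R e))) F"
      by (simp only: lborel_distr_plus) fact
    then show "integrable lborel (\<lambda>x. F (x + t k *\<^sub>R e))"
      by (subst (asm) integrable_distr_eq) (auto simp: add.commute)
  qed
  have "(\<integral>x. q k x \<partial>lborel) = 0" for k
    unfolding q_def using int_F lborel_integral_translate[OF F, of "t k *\<^sub>R e"] by simp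
  moreover have "(\<lambda>k. \<integral>x. q k x \<partial>lborel) \<longlonglongrightarrow> (\<integral>x. F' x \<partial>lborel)"
  proof (rule integral_dominated_convergence)
    show "integrable lborel (\<lambda>x::'a. \<bar>L\<bar> * norm e * indicator (cball 0 (R + norm e)) x)"
      using emeasure_bounded_finite[OF bounded_cball, of "0::'a" "R + norm e"]
      by (intro integrable_mult_right integrable_real_indicator) (auto simp: less_top)
    show "AE x in lborel. (\<lambda>k. q k x) \<longlonglongrightarrow> F' x"
      using deriv
    proof eventually_elim
      case (elim x)
      then have "((\<lambda>s. (F (x + s *\<^sub>R e) - F x) / s) \<longlongrightarrow> F' x) (at 0)"
        by (simp add: has_field_derivative_iff)
      moreover have "filterlim t (at 0) sequentially"
        unfolding filterlim_at using t t_pos by (auto intro!: always_eventually dest: less_imp_neq) (metis less_irrefl)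
      ultimately show ?case unfolding q_def by (rule filterlim_compose)
    qed
    show "AE x in lborel. norm (q k x) \<le> \<bar>L\<bar> * norm e * indicator (cball 0 (R + norm e)) x" for k
    proof (rule AE_I2)
      fix x :: 'a
      show "norm (q k x) \<le> \<bar>L\<bar> * norm e * indicator (cball 0 (R + norm e)) x"
      proof (cases "norm x \<le> R + norm e")
        case True
        have "\<bar>F (x + t k *\<^sub>R e) - F x\<bar> \<le> L * norm (t k *\<^sub>R e)" using lip[of "x + t k *\<^sub>R e" x] by simp
        also have "\<dots> \<le> \<bar>L\<bar> * norm (t k *\<^sub>R e)" by (intro mult_right_mono) auto
        finally show ?thesis using True t_pos[of k] by (simp add: q_def field_simps)
      next
        case False
        \<comment> \<open>Translating by at most \<open>norm e\<close> enlarges the support by at most \<open>norm e\<close>.\<close>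
        have "norm (t k *\<^sub>R e) \<le> norm e" using t_pos[of k] by (simp add: mult_left_le_one_le)
        moreover have "norm x \<le> norm (x + t k *\<^sub>R e) + norm (t k *\<^sub>R e)"
          using norm_triangle_ineq4[of "x + t k *\<^sub>R e" "t k *\<^sub>R e"] by simp
        moreover have "norm e \<ge> 0" by simp
        ultimately have "norm (x + t k *\<^sub>R e) > R" "norm x > R" using False by linarith+
        then show ?thesis using False supp by (simp add: q_def)
      qed
    qed
  qed auto
  ultimately show ?thesis by (simp add: LIMSEQ_const_iff)
qed

text \<open>
  The function \<open>(1 - x \<bullet> x)\<close> to the power \<open>p\<close>, cut off outside the unit ball. It is one power smoother
  than the Beta profile: for \<open>p = \<gamma> + 1\<close> its gradient is \<open>- 2 p x\<close> times the Beta profile with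
  parameter \<open>\<gamma>\<close> off the unit sphere. Moreover, it is Lipschitz even for \<open>\<gamma> = 0\<close>, where the profile itself jumps.
\<close>

definition ball_power :: "real \<Rightarrow> 'a::euclidean_space \<Rightarrow> real" where
  "ball_power p x = max 0 (1 - x \<bullet> x) powr p"

lemma inner_self_less_1_iff: "x \<bullet> x < 1 \<longleftrightarrow> norm (x::'a::real_inner) < 1"
  by (simp add: norm_eq_sqrt_inner)

lemma ball_power_measurable [measurable]: "ball_power p \<in> borel_measurable borel"
  unfolding ball_power_def by measurable

lemma ball_power_nonneg: "0 \<le> ball_power p x" by (simp add: ball_power_def)

lemma ball_power_outside: "norm x \<ge> 1 \<Longrightarrow> ball_power p x = 0"
  using inner_self_less_1_iff[of x] by (simp add: ball_power_def max_def)

lemma ball_power_le_1: "p \<ge> 0 \<Longrightarrow> ball_power p x \<le> 1"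
  unfolding ball_power_def by (rule powr_le1) auto

lemma powr_Lipschitz:
  assumes "p \<ge> 1" "0 \<le> a" "a \<le> 1" "0 \<le> b" "b \<le> (1::real)"
  shows "\<bar>a powr p - b powr p\<bar> \<le> p * \<bar>a - b\<bar>"
proof -
  have *: "b powr p - a powr p \<le> p * (b - a)" if "0 \<le> a" "a < b" "b \<le> 1" for a b :: real
  proof -
    have "\<exists>l z. a < z \<and> z < b \<and> DERIV (\<lambda>x. x powr p) z :> l \<and> b powr p - a powr p = (b - a) * l"
    proof (rule MVT[OF \<open>a < b\<close>])
      show "continuous_on {a..b} (\<lambda>x. x powr p)"
        using that assms by (intro continuous_on_powr') auto
      show "(\<lambda>x. x powr p) differentiable (at x)" if "a < x" for x
        using that \<open>0 \<le> a\<close> real_differentiable_def has_real_derivative_powr[of x p] by fastforce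
    qed
    then obtain l z where z: "a < z" "z < b" "DERIV (\<lambda>x. x powr p) z :> l"
      and eq: "b powr p - a powr p = (b - a) * l" by blast
    have "l = p * z powr (p - 1)"
      using z has_real_derivative_powr[of z p] that by (intro DERIV_unique[OF z(3)]) auto
    moreover have "z powr (p - 1) \<le> 1" using z that assms by (intro powr_le1) auto
    ultimately have "l \<le> p * 1" using assms by (simp only: mult_left_mono)
    then have "(b - a) * l \<le> (b - a) * p" using that by (intro mult_left_mono) auto
    then show ?thesis by (simp add: eq mult.commute)
  qed
  have "a powr p \<le> b powr p" if "a \<le> b" using that assms by (intro powr_mono2) auto
  moreover have "b powr p \<le> a powr p" if "b \<le> a" using that assms by (intro powr_mono2) auto
  ultimately show ?thesis
    using *[of a b] *[of b a] assms by (cases a b rule: linorder_cases) (auto simp: abs_if)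
qed

text \<open>
  The cut-off \<open>max 0 (1 - x \<bullet> x)\<close> is 2-Lipschitz, because \<open>x \<bullet> x - y \<bullet> y\<close> factors as the
  difference of the norms times their sum, which is at most \<open>2\<close> once the larger norm is truncated at
  \<open>1\<close>; the power \<open>p\<close> costs another factor \<open>p\<close> on \<open>[0, 1]\<close>.
\<close>

lemma ball_power_Lipschitz:
  assumes "p \<ge> 1"
  shows "\<bar>ball_power p x - ball_power p y\<bar> \<le> 2 * p * norm (x - y)"
proof -
  have *: "max 0 (1 - x \<bullet> x) - max 0 (1 - y \<bullet> y) \<le> 2 * norm (x - y)" for x y :: 'a
  proof (cases "norm x < 1")
    case True
    have d: "norm y - norm x \<le> norm (x - y)" by (metis norm_minus_commute norm_triangle_ineq2)
    have "1 - x \<bullet> x - max 0 (1 - y \<bullet> y) \<le> 2 * norm (x - y)"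
    proof (cases "norm y < norm x")
      case True
      then have "(norm y)\<^sup>2 \<le> (norm x)\<^sup>2" by (intro power_mono) auto
      then have "1 - x \<bullet> x - max 0 (1 - y \<bullet> y) \<le> 0" by (simp add: power2_norm_eq_inner)
      also have "0 \<le> 2 * norm (x - y)" by simp
      finally show ?thesis .
    next
      case False
      have "(min 1 (norm y) - norm x) * (min 1 (norm y) + norm x) \<le> (min 1 (norm y) - norm x) * 2"
        using True False by (intro mult_left_mono) auto
      also have "\<dots> \<le> 2 * norm (x - y)" using d by auto
      finally have "(min 1 (norm y))\<^sup>2 - x \<bullet> x \<le> 2 * norm (x - y)"
        by (simp add: power2_norm_eq_inner[symmetric] power2_eq_square algebra_simps)
      moreover have "1 - (min 1 (norm y))\<^sup>2 \<le> max 0 (1 - y \<bullet> y)"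
        by (auto simp: min_def power2_norm_eq_inner)
      ultimately show ?thesis by linarith
    qed
    then show ?thesis using True by (simp add: inner_self_less_1_iff max_def less_imp_le)
  next
    case False
    then have "max 0 (1 - x \<bullet> x) = 0" using inner_self_less_1_iff[of x] by auto
    moreover have "0 \<le> max 0 (1 - y \<bullet> y)" "0 \<le> norm (x - y)" by simp_all
    ultimately show ?thesis by linarith
  qed
  have "\<bar>ball_power p x - ball_power p y\<bar> \<le> p * \<bar>max 0 (1 - x \<bullet> x) - max 0 (1 - y \<bullet> y)\<bar>"
    unfolding ball_power_def using assms by (intro powr_Lipschitz) auto
  also have "\<dots> \<le> p * (2 * norm (x - y))"
    using *[of x y] *[of y x] assms by (intro mult_left_mono) (auto simp: norm_minus_commute abs_le_iff)
  finally show ?thesis by simp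
qed

text \<open>
  Multiplication by a coordinate preserves the Lipschitz property because the support is bounded: the
  product rule is applied with the unbounded factor evaluated at whichever point lies in the unit
  ball.
\<close>

lemma coordinate_ball_power_Lipschitz:
  fixes x y :: "real^'d::finite"
  assumes "p \<ge> 1"
  shows "\<bar>x $ j * ball_power p x - y $ j * ball_power p y\<bar> \<le> (2 * p + 1) * norm (x - y)"
proof -
  have *: "\<bar>x $ j * ball_power p x - y $ j * ball_power p y\<bar> \<le> (2 * p + 1) * norm (x - y)"
    if x: "norm x \<le> 1" for x y :: "real^'d"
  proof -
    have "x $ j * ball_power p x - y $ j * ball_power p y
        = x $ j * (ball_power p x - ball_power p y) + (x - y) $ j * ball_power p y"
      by (simp add: algebra_simps)
    also have "\<bar>\<dots>\<bar> \<le> \<bar>x $ j\<bar> * \<bar>ball_power p x - ball_power p y\<bar> + \<bar>(x - y) $ j\<bar> * \<bar>ball_power p y\<bar>"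
      by (metis abs_mult abs_triangle_ineq)
    also have "\<dots> \<le> 1 * (2 * p * norm (x - y)) + norm (x - y) * 1"
    proof (intro add_mono mult_mono)
      show "\<bar>x $ j\<bar> \<le> 1" using x component_le_norm_cart[of x j] by linarith
      show "\<bar>ball_power p y\<bar> \<le> 1" using assms ball_power_le_1[of p y] ball_power_nonneg[of p y] by simp
    qed (use assms component_le_norm_cart[of "x - y" j] in \<open>auto intro: ball_power_Lipschitz\<close>)
    finally show ?thesis by (simp add: algebra_simps)
  qed
  consider "norm x \<le> 1" | "norm y \<le> 1" | "norm x \<ge> 1" "norm y \<ge> 1" by linarith
  then show ?thesis
  proof cases
    case 2 then show ?thesis using *[of y x] by (simp add: norm_minus_commute abs_minus_commute)
  qed (use * assms in \<open>auto simp: ball_power_outside\<close>)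
qed

lemma beta_profile_measurable [measurable]: "beta_profile \<gamma> \<in> borel_measurable borel"
proof -
  have "(\<lambda>x::real^'d::finite. if \<gamma> = 0 then 1 else (1 - x \<bullet> x) powr \<gamma>) \<in> borel_measurable borel"
    by (cases "\<gamma> = 0") simp_all
  then show ?thesis
    unfolding beta_profile_def by (intro borel_measurable_times borel_measurable_indicator) auto
qed

lemma beta_profile_inside: "norm x < 1 \<Longrightarrow> beta_profile \<gamma> x = (1 - x \<bullet> x) powr \<gamma>"
proof -
  assume x: "norm x < 1"
  then have "x \<bullet> x < 1" by (simp only: inner_self_less_1_iff)
  then have "1 - x \<bullet> x \<noteq> 0" by linarith
  then show ?thesis using x by (simp add: beta_profile_def del: right_minus_eq)
qed

lemma beta_profile_outside: "norm x > 1 \<Longrightarrow> beta_profile \<gamma> x = 0"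
  by (simp add: beta_profile_def)

lemma beta_profile_nonneg: "0 \<le> beta_profile \<gamma> x"
  by (simp add: beta_profile_def)

lemma beta_profile_le_1: "\<gamma> \<ge> 0 \<Longrightarrow> beta_profile \<gamma> x \<le> 1"
proof (cases "norm x \<le> 1")
  case True
  assume "\<gamma> \<ge> 0"
  have "x \<bullet> x \<le> 1" using True power_le_one[of "norm x" 2] by (simp add: power2_norm_eq_inner)
  then have "(1 - x \<bullet> x) powr \<gamma> \<le> 1" using \<open>\<gamma> \<ge> 0\<close> by (intro powr_le1) auto
  then show ?thesis using True by (simp add: beta_profile_def)
qed (simp add: beta_profile_outside)

lemma ball_power_has_derivative_along_axis:
  fixes x :: "real^'d::finite"
  assumes "norm x \<noteq> 1"
  shows "((\<lambda>t. ball_power (\<gamma> + 1) (x + t *\<^sub>R axis i 1)) has_real_derivative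
    - (2 * (\<gamma> + 1)) * (x $ i * beta_profile \<gamma> x)) (at 0)"
proof -
  let ?f = "\<lambda>t. x + t *\<^sub>R axis i 1"
  have "((\<lambda>t. norm (?f t)) \<longlongrightarrow> norm (x + 0 *\<^sub>R axis i 1)) (nhds 0)"
    by (intro tendsto_intros filterlim_ident)
  then have lim: "((\<lambda>t. norm (?f t)) \<longlongrightarrow> norm x) (nhds 0)" by simp
  have f_inner: "?f t \<bullet> ?f t = x \<bullet> x + 2 * t * x $ i + t * t" for t
    by (simp add: inner_add_left inner_add_right inner_axis inner_axis' algebra_simps)
  consider "norm x < 1" | "norm x > 1" using assms by linarith
  then show ?thesis
  proof cases
    case 1
    have ev: "eventually (\<lambda>t. ball_power (\<gamma> + 1) (?f t) = (1 - (x \<bullet> x + 2 * t * x $ i + t * t)) powr (\<gamma> + 1)) (nhds 0)"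
      using order_tendstoD(2)[OF lim 1]
    proof eventually_elim
      case (elim t)
      then have "?f t \<bullet> ?f t < 1" by (simp only: inner_self_less_1_iff)
      then show ?case unfolding ball_power_def f_inner by simp
    qed
    have "x \<bullet> x < 1" using 1 by (simp only: inner_self_less_1_iff)
    then have "((\<lambda>t. (1 - (x \<bullet> x + 2 * t * x $ i + t * t)) powr (\<gamma> + 1)) has_real_derivative
        - (2 * (\<gamma> + 1)) * (x $ i * beta_profile \<gamma> x)) (at 0)"
      by (auto intro!: derivative_eq_intros simp: beta_profile_inside[OF 1] algebra_simps)
    then show ?thesis by (rule DERIV_cong_ev[OF refl ev refl, THEN iffD2])
  next
    case 2
    have ev: "eventually (\<lambda>t. ball_power (\<gamma> + 1) (?f t) = 0) (nhds 0)"
      using order_tendstoD(1)[OF lim 2] by eventually_elim (simp add: ball_power_outside)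
    have "((\<lambda>t. 0) has_real_derivative - (2 * (\<gamma> + 1)) * (x $ i * beta_profile \<gamma> x)) (at 0)"
      using beta_profile_outside[OF 2, of \<gamma>] by simp
    then show ?thesis by (rule DERIV_cong_ev[OF refl ev refl, THEN iffD2])
  qed
qed

lemma AE_norm_neq_1: "AE x in lborel. norm (x::'a::euclidean_space) \<noteq> 1"
proof -
  have "sphere (0::'a) 1 \<in> null_sets lborel"
    using negligible_sphere[of "0::'a" 1]
    by (auto simp: null_sets_completion_iff negligible_iff_null_sets negligible_convex_frontier)
  then show ?thesis by (rule AE_I') auto
qed

lemma coordinate_le_1: "norm (x::real^'d::finite) \<le> 1 \<Longrightarrow> \<bar>x $ i\<bar> \<le> 1"
  using component_le_norm_cart[of x i] by linarith

lemma coordinates_measurable [measurable]: "(\<lambda>x::real^'d::finite. x $ i) \<in> borel_measurable borel"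
  by (intro borel_measurable_continuous_onI continuous_intros)

lemma integrable_beta_profile_times:
  fixes q :: "real^'d::finite \<Rightarrow> real"
  assumes "\<gamma> \<ge> 0" and [measurable]: "q \<in> borel_measurable borel"
    and q: "\<And>x. norm x \<le> 1 \<Longrightarrow> \<bar>q x\<bar> \<le> B"
  shows "integrable lborel (\<lambda>x. q x * beta_profile \<gamma> x)"
proof (rule integrable_lborel_bounded_support[where B = B and R = 1])
  have B: "B \<ge> 0" using q[of 0] by auto
  show "\<bar>q x * beta_profile \<gamma> x\<bar> \<le> B" for x
  proof (cases "norm x \<le> 1")
    case True
    have "\<bar>q x\<bar> * \<bar>beta_profile \<gamma> x\<bar> \<le> B * 1"
      using assms(1) q[OF True] B by (intro mult_mono) (auto simp: beta_profile_nonneg beta_profile_le_1)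
    then show ?thesis by (simp add: abs_mult)
  qed (simp add: beta_profile_outside B)
  show "(\<lambda>x. q x * beta_profile \<gamma> x) \<in> borel_measurable borel" by measurable
qed (simp add: beta_profile_outside)

lemma coordinate_product_le_1: "norm (x::real^'d::finite) \<le> 1 \<Longrightarrow> \<bar>x $ i * x $ j\<bar> \<le> 1"
  unfolding abs_mult by (intro mult_le_one coordinate_le_1 abs_ge_zero)

text \<open>
  Up to the factor \<open>- 2 (\<gamma> + 1)\<close> the integrand is a partial derivative of
  \<^term>\<open>ball_power (\<gamma> + 1)\<close>.
\<close>

lemma beta_profile_first_moment:
  assumes "\<gamma> \<ge> 0"
  shows "(\<integral>x. x $ i * beta_profile \<gamma> (x::real^'d::finite) \<partial>lborel) = 0"
proof -
  have "(\<integral>x. - (2 * (\<gamma> + 1)) * (x $ i * beta_profile \<gamma> (x::real^'d)) \<partial>lborel) = 0"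
  proof (rule integral_directional_derivative_eq_0[where F = "ball_power (\<gamma> + 1)" and e = "axis i 1"
        and R = 1 and B = 1 and L = "2 * (\<gamma> + 1)"])
    show "AE x in lborel. ((\<lambda>t. ball_power (\<gamma> + 1) (x + t *\<^sub>R axis i 1)) has_real_derivative
      - (2 * (\<gamma> + 1)) * (x $ i * beta_profile \<gamma> x)) (at 0)"
      using AE_norm_neq_1 by eventually_elim (rule ball_power_has_derivative_along_axis)
    show "\<bar>ball_power (\<gamma> + 1) x\<bar> \<le> 1" for x :: "real^'d"
      using assms by (simp add: ball_power_nonneg ball_power_le_1)
    show "\<bar>ball_power (\<gamma> + 1) x - ball_power (\<gamma> + 1) y\<bar> \<le> 2 * (\<gamma> + 1) * norm (x - y)" for x y :: "real^'d"
      using assms by (intro ball_power_Lipschitz) auto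
    show "(\<lambda>x. - (2 * (\<gamma> + 1)) * (x $ i * beta_profile \<gamma> x)) \<in> borel_measurable borel" by measurable
  qed (auto simp: ball_power_outside)
  then show ?thesis using assms by simp
qed

text \<open>
  The partial derivative in direction \<open>i\<close> of \<open>x\<^sub>j\<close> times \<^term>\<open>ball_power (\<gamma> + 1)\<close> consists
  of the two integrands that are compared here; it integrates to zero.
\<close>

lemma beta_profile_second_moment_ball_power:
  assumes "\<gamma> \<ge> 0"
  shows "2 * (\<gamma> + 1) * (\<integral>x. x $ i * x $ j * beta_profile \<gamma> (x::real^'d::finite) \<partial>lborel) =
    (if i = j then \<integral>x. ball_power (\<gamma> + 1) (x::real^'d) \<partial>lborel else 0)"
proof -
  let ?\<delta> = "if i = j then 1 else 0 :: real"
  have "(\<integral>x. ?\<delta> * ball_power (\<gamma> + 1) x - 2 * (\<gamma> + 1) * (x $ i * x $ j * beta_profile \<gamma> (x::real^'d)) \<partial>lborel) = 0"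
  proof (rule integral_directional_derivative_eq_0[where F = "\<lambda>x. x $ j * ball_power (\<gamma> + 1) x" and e = "axis i 1"
        and R = 1 and B = 1 and L = "2 * (\<gamma> + 1) + 1"])
    show "AE x in lborel. ((\<lambda>t. (x + t *\<^sub>R axis i 1) $ j * ball_power (\<gamma> + 1) (x + t *\<^sub>R axis i 1))
      has_real_derivative ?\<delta> * ball_power (\<gamma> + 1) x
        - 2 * (\<gamma> + 1) * (x $ i * x $ j * beta_profile \<gamma> (x::real^'d))) (at 0)"
      using AE_norm_neq_1
    proof eventually_elim
      case (elim x)
      have "((\<lambda>t. (x + t *\<^sub>R axis i 1) $ j) has_real_derivative ?\<delta>) (at 0)"
        by (auto intro!: derivative_eq_intros simp: axis_def)
      from DERIV_mult[OF this ball_power_has_derivative_along_axis[OF elim, of \<gamma> i]]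
      show ?case by (simp add: algebra_simps)
    qed
    show "\<bar>x $ j * ball_power (\<gamma> + 1) x\<bar> \<le> 1" for x :: "real^'d"
    proof (cases "norm x \<le> 1")
      case True
      have "\<bar>x $ j\<bar> * \<bar>ball_power (\<gamma> + 1) x\<bar> \<le> 1 * 1"
        using assms coordinate_le_1[OF True]
        by (intro mult_mono) (auto simp: ball_power_nonneg ball_power_le_1)
      then show ?thesis by (simp add: abs_mult)
    qed (simp add: ball_power_outside)
    show "\<bar>x $ j * ball_power (\<gamma> + 1) x - y $ j * ball_power (\<gamma> + 1) y\<bar> \<le> (2 * (\<gamma> + 1) + 1) * norm (x - y)"
      for x y :: "real^'d"
      using assms by (intro coordinate_ball_power_Lipschitz) auto
    show "(\<lambda>x. ?\<delta> * ball_power (\<gamma> + 1) x - 2 * (\<gamma> + 1) * (x $ i * x $ j * beta_profile \<gamma> (x::real^'d)))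
      \<in> borel_measurable borel" by measurable
    show "(\<lambda>x::real^'d. x $ j * ball_power (\<gamma> + 1) x) \<in> borel_measurable borel" by measurable
  qed (auto simp: ball_power_outside)
  moreover have "integrable lborel (\<lambda>x::real^'d. ball_power (\<gamma> + 1) x)"
    using assms by (intro integrable_lborel_bounded_support[where B = 1 and R = 1])
      (auto simp: ball_power_nonneg ball_power_le_1 ball_power_outside)
  moreover have "integrable lborel (\<lambda>x::real^'d. x $ i * x $ j * beta_profile \<gamma> x)"
    by (rule integrable_beta_profile_times[OF assms _ coordinate_product_le_1]) simp
  ultimately have "?\<delta> * (\<integral>x. ball_power (\<gamma> + 1) (x::real^'d) \<partial>lborel) =
      2 * (\<gamma> + 1) * (\<integral>x. x $ i * x $ j * beta_profile \<gamma> (x::real^'d) \<partial>lborel)"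
    by simp
  then show ?thesis by (cases "i = j") simp_all
qed

text \<open>
  On the ball of radius \<open>1/2\<close> the profile is at least \<open>(3/4)\<close> to the power \<open>\<gamma>\<close>.
\<close>

lemma beta_const_pos:
  assumes "\<gamma> \<ge> 0"
  shows "beta_const TYPE('d::finite) \<gamma> > 0"
proof -
  let ?c = "(3 / 4) powr \<gamma> :: real"
  have "0 < ?c * measure lborel (ball (0::real^'d) (1 / 2))"
    by (intro mult_pos_pos content_ball_pos) auto
  also have "\<dots> = (\<integral>x. ?c * indicator (ball 0 (1 / 2)) (x::real^'d) \<partial>lborel)"
    by simp
  also have "\<dots> \<le> (\<integral>x. beta_profile \<gamma> (x::real^'d) \<partial>lborel)"
  proof (rule integral_mono)
    show "integrable lborel (\<lambda>x::real^'d. ?c * indicator (ball 0 (1 / 2)) x)"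
      using emeasure_bounded_finite[OF bounded_ball, of "0::real^'d" "1 / 2"]
      by (intro integrable_mult_right integrable_real_indicator) (auto simp: less_top)
    show "integrable lborel (\<lambda>x::real^'d. beta_profile \<gamma> x)"
      using integrable_beta_profile_times[OF assms, of "\<lambda>_. 1" 1] by simp
    fix x :: "real^'d"
    show "?c * indicator (ball 0 (1 / 2)) x \<le> beta_profile \<gamma> x"
    proof (cases "norm x < 1 / 2")
      case True
      have "(norm x)\<^sup>2 \<le> (1 / 2)\<^sup>2" using True by (intro power_mono) auto
      then have "x \<bullet> x \<le> (1 / 2)\<^sup>2" by (simp only: power2_norm_eq_inner)
      then have "3 / 4 \<le> 1 - x \<bullet> x" by (simp add: power2_eq_square)
      then have "?c \<le> (1 - x \<bullet> x) powr \<gamma>" using assms by (intro powr_mono2) auto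
      then show ?thesis using True by (simp add: beta_profile_inside)
    qed (simp add: beta_profile_nonneg)
  qed
  finally show ?thesis by (simp add: beta_const_def)
qed

text \<open>
  On the unit sphere the profile is \<open>1\<close> for \<open>\<gamma> = 0\<close> and \<open>0\<close> otherwise; in both cases the factor
  \<open>1 - x \<bullet> x\<close> vanishes there.
\<close>

lemma ball_power_add_1: "ball_power (\<gamma> + 1) x = (1 - x \<bullet> x) * beta_profile \<gamma> x"
proof -
  consider "norm x < 1" | "norm x = 1" | "norm x > 1" by linarith
  then show ?thesis
  proof cases
    case 1
    then have "x \<bullet> x < 1" by (simp only: inner_self_less_1_iff)
    then show ?thesis using 1 by (simp add: beta_profile_inside ball_power_def powr_add)
  next
    case 2
    then show ?thesis by (simp add: ball_power_outside flip: power2_norm_eq_inner)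
  qed (simp add: ball_power_outside beta_profile_outside)
qed

text \<open>
  Let \<open>A\<close> be the integral of the profile, \<open>I\<close> that of \<^term>\<open>ball_power (\<gamma> + 1)\<close> and \<open>m\<close> the common
  diagonal moment. The preceding identity says \<open>2 (\<gamma> + 1) m = I\<close>, and integrating
  \<open>(1 - x \<bullet> x)\<close> times the profile gives \<open>I = A - d m\<close>. Solving this linear system yields \<open>m\<close>.
\<close>

lemma beta_profile_second_moment:
  assumes "\<gamma> \<ge> 0"
  shows "(\<integral>x. x $ i * x $ j * beta_profile \<gamma> (x::real^'d::finite) \<partial>lborel) =
    (if i = j then beta_const TYPE('d) \<gamma> / (real CARD('d) + 2 * \<gamma> + 2) else 0)"
proof -
  define m where "m i j = (\<integral>x. x $ i * x $ j * beta_profile \<gamma> (x::real^'d) \<partial>lborel)" for i j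
  define I where "I = (\<integral>x. ball_power (\<gamma> + 1) (x::real^'d) \<partial>lborel)"
  define A where "A = beta_const TYPE('d) \<gamma>"
  have m: "2 * (\<gamma> + 1) * m i j = (if i = j then I else 0)" for i j
    using beta_profile_second_moment_ball_power[OF assms, of i j] by (simp add: m_def I_def)
  have int: "integrable lborel (\<lambda>x::real^'d. x $ i * x $ j * beta_profile \<gamma> x)" for i j
    by (rule integrable_beta_profile_times[OF assms _ coordinate_product_le_1]) simp
  have int1: "integrable lborel (\<lambda>x::real^'d. beta_profile \<gamma> x)"
    using integrable_beta_profile_times[OF assms, of "\<lambda>_. 1" 1] by simp
  have "I = (\<integral>x. beta_profile \<gamma> (x::real^'d) - (\<Sum>i\<in>UNIV. x $ i * x $ i * beta_profile \<gamma> x) \<partial>lborel)"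
    unfolding I_def ball_power_add_1
    by (intro Bochner_Integration.integral_cong) (simp_all add: inner_vec_def sum_distrib_right left_diff_distrib)
  also have "\<dots> = A - (\<Sum>i\<in>UNIV. m i i)"
    using int int1 by (simp add: A_def beta_const_def m_def)
  finally have "2 * (\<gamma> + 1) * I = 2 * (\<gamma> + 1) * A - (\<Sum>i\<in>(UNIV::'d set). 2 * (\<gamma> + 1) * m i i)"
    by (simp add: right_diff_distrib flip: sum_distrib_left)
  also have "\<dots> = 2 * (\<gamma> + 1) * A - real CARD('d) * I"
    by (simp only: m) simp
  finally have I: "I * (real CARD('d) + 2 * \<gamma> + 2) = 2 * (\<gamma> + 1) * A"
    by (simp add: algebra_simps)
  have pos: "real CARD('d) + 2 * \<gamma> + 2 > 0" using assms by simp
  have "2 * (\<gamma> + 1) * m i i = I" using m[of i i] by simp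
  also have "I = 2 * (\<gamma> + 1) * (A / (real CARD('d) + 2 * \<gamma> + 2))"
    using I pos by (simp only: eq_divide_eq times_divide_eq_right) auto
  finally have "2 * (\<gamma> + 1) * m i i = 2 * (\<gamma> + 1) * (A / (real CARD('d) + 2 * \<gamma> + 2))" .
  moreover have "2 * (\<gamma> + 1) \<noteq> 0" using assms by simp
  ultimately have "m i i = A / (real CARD('d) + 2 * \<gamma> + 2)" using mult_left_cancel by blast
  moreover have "m i j = 0" if "i \<noteq> j" using m[of i j] that assms by simp
  ultimately have "m i j = (if i = j then A / (real CARD('d) + 2 * \<gamma> + 2) else 0)"
    by (cases "i = j") auto
  then show ?thesis by (simp only: m_def A_def)
qed

lemma beta_kernel_measurable [measurable]: "beta_kernel \<gamma> \<in> borel_measurable borel"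
  unfolding beta_kernel_def by measurable

lemma beta_kernel_nonneg: "\<gamma> \<ge> 0 \<Longrightarrow> 0 \<le> beta_kernel \<gamma> (x::real^'d::finite)"
  using beta_const_pos[of \<gamma>, where 'd = 'd] by (simp add: beta_kernel_def beta_profile_nonneg)

lemma beta_kernel_le: "\<gamma> \<ge> 0 \<Longrightarrow> beta_kernel \<gamma> (x::real^'d::finite) \<le> 1 / beta_const TYPE('d) \<gamma>"
  using beta_const_pos[of \<gamma>, where 'd = 'd] by (simp add: beta_kernel_def beta_profile_le_1 divide_right_mono)

lemma beta_kernel_outside: "norm x > 1 \<Longrightarrow> beta_kernel \<gamma> x = 0"
  by (simp add: beta_kernel_def beta_profile_outside)

lemma integrable_beta_kernel_times:
  fixes q :: "real^'d::finite \<Rightarrow> real"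
  assumes "\<gamma> \<ge> 0" "q \<in> borel_measurable borel"
    and "\<And>x. norm x \<le> 1 \<Longrightarrow> \<bar>q x\<bar> \<le> B"
  shows "integrable lborel (\<lambda>x. q x * beta_kernel \<gamma> x)"
  using integrable_beta_profile_times[OF assms] by (simp add: beta_kernel_def)

lemma beta_kernel_integral:
  "\<gamma> \<ge> 0 \<Longrightarrow> (\<integral>x. beta_kernel \<gamma> (x::real^'d::finite) \<partial>lborel) = 1"
  using beta_const_pos[of \<gamma>, where 'd = 'd] by (simp add: beta_kernel_def) (simp add: beta_const_def)

lemma beta_kernel_first_moment:
  "\<gamma> \<ge> 0 \<Longrightarrow> (\<integral>x. x $ i * beta_kernel \<gamma> (x::real^'d::finite) \<partial>lborel) = 0"
  by (simp add: beta_kernel_def beta_profile_first_moment)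

lemma beta_kernel_second_moment:
  "\<gamma> \<ge> 0 \<Longrightarrow> (\<integral>x. x $ i * x $ j * beta_kernel \<gamma> (x::real^'d::finite) \<partial>lborel) =
    (if i = j then 1 / (real CARD('d) + 2 * \<gamma> + 2) else 0)"
  using beta_const_pos[of \<gamma>, where 'd = 'd]
  by (simp add: beta_kernel_def beta_profile_second_moment)

lemma integrable_beta_kernel_square_times:
  fixes q :: "real^'d::finite \<Rightarrow> real"
  assumes \<gamma>: "\<gamma> \<ge> 0" and q: "q \<in> borel_measurable borel" "\<And>x. norm x \<le> 1 \<Longrightarrow> \<bar>q x\<bar> \<le> B"
  shows "integrable lborel (\<lambda>x. q x * (beta_kernel \<gamma> x)\<^sup>2)"
proof -
  have "B \<ge> 0" using q(2)[of 0] by auto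
  then have "\<bar>q x * beta_kernel \<gamma> x\<bar> \<le> B * (1 / beta_const TYPE('d) \<gamma>)" if "norm x \<le> 1" for x :: "real^'d"
    unfolding abs_mult using q(2)[OF that] beta_kernel_nonneg[OF \<gamma>, of x] beta_kernel_le[OF \<gamma>, of x]
    by (intro mult_mono) auto
  from integrable_beta_kernel_times[OF \<gamma> _ this, of "\<lambda>x. x"] q(1) show ?thesis
    by (simp add: power2_eq_square mult.assoc)
qed

text \<open>
  Integrated against the kernel, a quadratic polynomial retains only its constant term and the trace
  of its quadratic part.
\<close>

lemma beta_kernel_quadratic_integral:
  fixes b :: "'d::finite \<Rightarrow> real"
  assumes "\<gamma> \<ge> 0"
  shows "integrable lborel (\<lambda>u::real^'d.
      (c + (\<Sum>i\<in>UNIV. b i * u $ i) + (\<Sum>i\<in>UNIV. \<Sum>j\<in>UNIV. H i j * (u $ i * u $ j))) * beta_kernel \<gamma> u)"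
    and "(\<integral>u. (c + (\<Sum>i\<in>UNIV. b i * u $ i) + (\<Sum>i\<in>UNIV. \<Sum>j\<in>UNIV. H i j * (u $ i * u $ j)))
        * beta_kernel \<gamma> (u::real^'d) \<partial>lborel)
      = c + (\<Sum>i\<in>UNIV. H i i) / (real CARD('d) + 2 * \<gamma> + 2)"
proof -
  have int0: "integrable lborel (\<lambda>u::real^'d. beta_kernel \<gamma> u)"
    using integrable_beta_kernel_times[OF assms, of "\<lambda>_. 1" 1] by simp
  have int1: "integrable lborel (\<lambda>u::real^'d. u $ i * beta_kernel \<gamma> u)" for i
    by (rule integrable_beta_kernel_times[OF assms _ coordinate_le_1]) simp
  have int2: "integrable lborel (\<lambda>u::real^'d. u $ i * u $ j * beta_kernel \<gamma> u)" for i j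
    by (rule integrable_beta_kernel_times[OF assms _ coordinate_product_le_1]) simp
  have eq: "(\<lambda>u::real^'d. (c + (\<Sum>i\<in>UNIV. b i * u $ i) + (\<Sum>i\<in>UNIV. \<Sum>j\<in>UNIV. H i j * (u $ i * u $ j)))
        * beta_kernel \<gamma> u) =
      (\<lambda>u. c * beta_kernel \<gamma> u + (\<Sum>i\<in>UNIV. b i * (u $ i * beta_kernel \<gamma> u))
        + (\<Sum>i\<in>UNIV. \<Sum>j\<in>UNIV. H i j * (u $ i * u $ j * beta_kernel \<gamma> u)))"
    by (simp add: distrib_right sum_distrib_right mult.assoc)
  show "integrable lborel (\<lambda>u::real^'d.
      (c + (\<Sum>i\<in>UNIV. b i * u $ i) + (\<Sum>i\<in>UNIV. \<Sum>j\<in>UNIV. H i j * (u $ i * u $ j))) * beta_kernel \<gamma> u)"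
    unfolding eq using int0 int1 int2
    by (intro Bochner_Integration.integrable_add Bochner_Integration.integrable_sum integrable_mult_right) 
  have diag: "(\<Sum>i\<in>UNIV. \<Sum>j\<in>UNIV. H i j * (if i = j then w else 0)) = (\<Sum>i\<in>UNIV. H i i * w)"
    for w :: real
    by (simp add: if_distrib sum.delta' cong: if_cong)
  show "(\<integral>u. (c + (\<Sum>i\<in>UNIV. b i * u $ i) + (\<Sum>i\<in>UNIV. \<Sum>j\<in>UNIV. H i j * (u $ i * u $ j)))
        * beta_kernel \<gamma> (u::real^'d) \<partial>lborel)
      = c + (\<Sum>i\<in>UNIV. H i i) / (real CARD('d) + 2 * \<gamma> + 2)"
    unfolding eq using int0 int1 int2
    by (simp add: beta_kernel_integral[OF assms] beta_kernel_first_moment[OF assms]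
        beta_kernel_second_moment[OF assms] diag sum_divide_distrib)
qed

section \<open>Taylor expansion from continuous partial derivatives\<close>

lemma partial_along_axis:
  fixes f :: "real^'d::finite \<Rightarrow> real"
  assumes "C1_on W f" "x + t *\<^sub>R axis i 1 \<in> W"
  shows "((\<lambda>s. f (x + s *\<^sub>R axis i 1)) has_real_derivative partial i f (x + t *\<^sub>R axis i 1)) (at t)"
proof -
  let ?y = "x + t *\<^sub>R axis i 1"
  have "((\<lambda>s. f (?y + s *\<^sub>R axis i 1)) has_real_derivative partial i f ?y) (at 0)"
    using assms unfolding C1_on_def partial_def by (simp add: DERIV_deriv_iff_field_differentiable)
  then have "((\<lambda>s. f (?y + (s - t) *\<^sub>R axis i 1)) has_real_derivative partial i f ?y * 1) (at t)"
    by (intro DERIV_chain2[where f = "\<lambda>s. f (?y + s *\<^sub>R axis i 1)" and g = "\<lambda>s. s - t"])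
       (auto intro!: derivative_eq_intros)
  then show ?thesis by (simp add: algebra_simps)
qed

text \<open>
  Partial derivatives that exist and are continuous on an open set give a total derivative; this is
  what makes the chain rule along arbitrary lines available.
\<close>

lemma C1_on_has_derivative:
  fixes f :: "real^'d::finite \<Rightarrow> real"
  assumes f: "C1_on W f" and W: "open W" and x: "x \<in> W"
  shows "(f has_derivative (\<lambda>v. \<Sum>i\<in>UNIV. v $ i * partial i f x)) (at x)"
  unfolding has_derivative_at_alt
proof (intro conjI allI impI)
  show "bounded_linear (\<lambda>v. \<Sum>i\<in>UNIV. v $ i * partial i f x)"
    by (intro bounded_linear_sum bounded_linear_mult_const bounded_linear_vec_nth)
next
  fix e :: real assume e: "e > 0"
  define e' where "e' = e / real CARD('d)"
  have e': "e' > 0" using e by (simp add: e'_def)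
  have "eventually (\<lambda>y. \<forall>i. \<bar>partial i f y - partial i f x\<bar> < e') (nhds x)"
  proof (rule eventually_all_finite)
    fix i
    have "isCont (partial i f) x"
      using f W x by (auto simp: C1_on_def continuous_on_eq_continuous_at)
    then have "(partial i f \<longlongrightarrow> partial i f x) (nhds x)"
      by (simp add: isCont_def tendsto_at_iff_tendsto_nhds)
    then show "eventually (\<lambda>y. \<bar>partial i f y - partial i f x\<bar> < e') (nhds x)"
      using e' by (auto dest!: tendstoD simp: dist_real_def)
  qed
  moreover have "eventually (\<lambda>y. y \<in> W) (nhds x)"
    using W x by (simp add: eventually_nhds_in_open)
  ultimately have "eventually (\<lambda>y. y \<in> W \<and> (\<forall>i. \<bar>partial i f y - partial i f x\<bar> < e')) (nhds x)"
    by eventually_elim auto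
  then obtain r where r: "r > 0"
    and near: "\<And>y. dist y x < r \<Longrightarrow> y \<in> W \<and> (\<forall>i. \<bar>partial i f y - partial i f x\<bar> < e')"
    unfolding eventually_nhds_metric by blast
  show "\<exists>d>0. \<forall>y. norm (y - x) < d \<longrightarrow>
      norm (f y - f x - (\<Sum>i\<in>UNIV. (y - x) $ i * partial i f x)) \<le> e * norm (y - x)"
  proof (intro exI[of _ r] conjI allI impI r)
    fix y assume y: "norm (y - x) < r"
    define v where "v = y - x"
    define p where "p S = (\<Sum>i\<in>S. v $ i *\<^sub>R (axis i 1 :: real^'d))" for S
    have p_nth: "p S $ j = (if j \<in> S then v $ j else 0)" for S j
    proof -
      have "p S $ j = (\<Sum>i\<in>S. if i = j then v $ i else 0)"
        unfolding p_def sum_component by (intro sum.cong) (auto simp: axis_def)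
      then show ?thesis by simp
    qed
    \<comment> \<open>Change one coordinate at a time, so that only derivatives along axes occur.\<close>
    have step: "\<bar>f (x + p S) - f x - (\<Sum>i\<in>S. v $ i * partial i f x)\<bar> \<le> e' * (\<Sum>i\<in>S. \<bar>v $ i\<bar>)" for S
    proof (induction S rule: finite_induct[OF finite])
      case 1 then show ?case by (simp add: p_def)
    next
      case (2 i S)
      define \<phi> where "\<phi> t = f ((x + p S) + t *\<^sub>R axis i 1) - t * partial i f x" for t
      have close: "dist ((x + p S) + t *\<^sub>R axis i 1) x < r" if "t \<in> closed_segment 0 (v $ i)" for t
      proof -
        have t: "\<bar>t\<bar> \<le> \<bar>v $ i\<bar>" using that by (auto simp: closed_segment_eq_real_ivl split: if_splits)
        have "norm (p S + t *\<^sub>R axis i 1) \<le> norm v"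
          using t 2 by (intro norm_le_componentwise_cart) (auto simp: p_nth axis_def)
        then show ?thesis using y by (simp add: dist_norm v_def add.assoc)
      qed
      have "norm (\<phi> (v $ i) - \<phi> 0) \<le> e' * norm (v $ i - 0)"
      proof (rule field_differentiable_bound[where S = "closed_segment 0 (v $ i)"
            and f' = "\<lambda>t. partial i f ((x + p S) + t *\<^sub>R axis i 1) - partial i f x"])
        fix t assume t: "t \<in> closed_segment 0 (v $ i)"
        have "(x + p S) + t *\<^sub>R axis i 1 \<in> W" by (rule near[OF close[OF t], THEN conjunct1])
        from DERIV_diff[OF partial_along_axis[OF f this] DERIV_cmult_right[OF DERIV_ident]]
        show "(\<phi> has_field_derivative partial i f ((x + p S) + t *\<^sub>R axis i 1) - partial i f x)
            (at t within closed_segment 0 (v $ i))"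
          unfolding \<phi>_def by (simp add: has_field_derivative_at_within)
        show "norm (partial i f ((x + p S) + t *\<^sub>R axis i 1) - partial i f x) \<le> e'"
          using near[OF close[OF t]] by (simp add: less_imp_le)
      qed auto
      moreover have "p (insert i S) = p S + v $ i *\<^sub>R axis i 1"
        using 2 by (simp add: p_def)
      ultimately have "\<bar>f (x + p (insert i S)) - f (x + p S) - v $ i * partial i f x\<bar> \<le> e' * \<bar>v $ i\<bar>"
        by (simp add: \<phi>_def algebra_simps)
      with 2 show ?case by (simp add: algebra_simps)
    qed
    have "x + p UNIV = y" by (auto simp: vec_eq_iff p_nth v_def)
    with step[of UNIV] have "\<bar>f y - f x - (\<Sum>i\<in>UNIV. v $ i * partial i f x)\<bar> \<le> e' * (\<Sum>i\<in>UNIV. \<bar>v $ i\<bar>)"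
      by simp
    also have "\<dots> \<le> e' * (\<Sum>i\<in>(UNIV::'d set). norm v)"
      using e' by (intro mult_left_mono sum_mono) (auto simp: component_le_norm_cart)
    also have "\<dots> = e * norm v" by (simp add: e'_def)
    finally show "norm (f y - f x - (\<Sum>i\<in>UNIV. (y - x) $ i * partial i f x)) \<le> e * norm (y - x)"
      by (simp add: v_def)
  qed
qed

lemma C1_on_has_derivative_along_line:
  fixes f :: "real^'d::finite \<Rightarrow> real"
  assumes f: "C1_on W f" and W: "open W" and x: "x + t *\<^sub>R v \<in> W"
  shows "((\<lambda>s. f (x + s *\<^sub>R v)) has_real_derivative (\<Sum>i\<in>UNIV. v $ i * partial i f (x + t *\<^sub>R v))) (at t)"
proof -
  have "((\<lambda>s. x + s *\<^sub>R v) has_derivative (\<lambda>s. s *\<^sub>R v)) (at t)"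
    by (auto intro!: derivative_eq_intros)
  from has_derivative_compose[OF this C1_on_has_derivative[OF f W x]]
  show ?thesis
    unfolding has_field_derivative_def
    by (rule has_derivative_eq_rhs) (auto simp: sum_distrib_left mult_ac)
qed

text \<open>
  Taylor's formula is applied to the restriction of \<open>f\<close> to the segment from \<open>x\<close> to \<open>x + v\<close>. The Lagrange
  remainder is the second derivative at an intermediate point; replacing that point by \<open>x\<close> changes
  each of the \<open>d\<^sup>2\<close> second partial derivatives by at most \<open>C\<close> times the norm of \<open>v\<close> to the power \<open>\<alpha>\<close>.
\<close>

lemma C2_on_Taylor:
  fixes f :: "real^'d::finite \<Rightarrow> real"
  assumes f: "C2_on W f" and W: "open W" "cball x r \<subseteq> W"
    and C: "C \<ge> 0" and \<alpha>: "\<alpha> > 0"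
    and Hoelder: "\<And>i j x y. x \<in> W \<Longrightarrow> y \<in> W \<Longrightarrow>
           \<bar>partial i (partial j f) x - partial i (partial j f) y\<bar> \<le> C * norm (x - y) powr \<alpha>"
    and v: "norm v \<le> r"
  shows "\<bar>f (x + v) - f x - (\<Sum>i\<in>UNIV. v $ i * partial i f x)
      - (\<Sum>i\<in>UNIV. \<Sum>j\<in>UNIV. v $ i * v $ j * partial j (partial i f) x) / 2\<bar>
    \<le> C * (real CARD('d))\<^sup>2 / 2 * norm v powr (2 + \<alpha>)"
proof (cases "v = 0")
  case False
  then have r: "r > 0" using v by (auto intro: less_le_trans[of 0 "norm v"])
  have inW: "x + t *\<^sub>R v \<in> W" if "0 \<le> t" "t \<le> 1" for t
  proof -
    have "\<bar>t\<bar> * norm v \<le> 1 * r" using that v by (intro mult_mono) auto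
    then have "x + t *\<^sub>R v \<in> cball x r" by (simp add: dist_norm)
    then show ?thesis using W by blast
  qed
  define H where "H t = (\<Sum>i\<in>UNIV. v $ i * (\<Sum>j\<in>UNIV. v $ j * partial j (partial i f) (x + t *\<^sub>R v)))" for t
  \<comment> \<open>The derivatives of order 0, 1 and 2 of \<open>f\<close> along the segment.\<close>
  define diff where "diff m = (case m of 0 \<Rightarrow> \<lambda>t. f (x + t *\<^sub>R v)
     | Suc 0 \<Rightarrow> \<lambda>t. \<Sum>i\<in>UNIV. v $ i * partial i f (x + t *\<^sub>R v) | _ \<Rightarrow> H)" for m :: nat
  have "\<forall>m t. m < 2 \<and> 0 \<le> t \<and> t \<le> 1 \<longrightarrow> DERIV (diff m) t :> diff (Suc m) t"
  proof (intro allI impI)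
    fix m :: nat and t :: real assume *: "m < 2 \<and> 0 \<le> t \<and> t \<le> 1"
    then have t: "x + t *\<^sub>R v \<in> W" using inW by auto
    have f1: "C1_on W f" "C1_on W (partial i f)" for i using f by (auto simp: C2_on_def)
    from * consider "m = 0" | "m = 1" by linarith
    then show "DERIV (diff m) t :> diff (Suc m) t"
    proof cases
      case 1 then show ?thesis
        using C1_on_has_derivative_along_line[OF f1(1) W(1) t] by (simp add: diff_def)
    next
      case 2
      have "((\<lambda>t. \<Sum>i\<in>UNIV. v $ i * partial i f (x + t *\<^sub>R v)) has_real_derivative H t) (at t)"
        unfolding H_def
        by (intro DERIV_sum DERIV_cmult C1_on_has_derivative_along_line[OF f1(2) W(1) t])
      with 2 show ?thesis by (simp add: diff_def)
    qed
  qed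
  then obtain t where t: "0 < t" "t < 1"
    and eq: "f (x + 1 *\<^sub>R v) = (\<Sum>m<2. diff m 0 / fact m * 1 ^ m) + diff 2 t / fact 2 * 1 ^ 2"
    using Maclaurin[of 1 2 diff "\<lambda>t. f (x + t *\<^sub>R v)"] by (auto simp: diff_def)
  have eq': "f (x + v) = f x + (\<Sum>i\<in>UNIV. v $ i * partial i f x) + H t / 2"
    using eq by (simp add: diff_def numeral_2_eq_2)
  have H0: "H 0 = (\<Sum>i\<in>UNIV. \<Sum>j\<in>UNIV. v $ i * v $ j * partial j (partial i f) x)"
    by (simp add: H_def sum_distrib_left mult_ac)
  have "\<bar>H t - H 0\<bar> = \<bar>\<Sum>i\<in>UNIV. \<Sum>j\<in>UNIV.
      v $ i * v $ j * (partial j (partial i f) (x + t *\<^sub>R v) - partial j (partial i f) x)\<bar>"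
    by (simp add: H_def sum_distrib_left sum_subtractf algebra_simps)
  also have "\<dots> \<le> (\<Sum>i\<in>UNIV. \<Sum>j\<in>UNIV.
      \<bar>v $ i * v $ j * (partial j (partial i f) (x + t *\<^sub>R v) - partial j (partial i f) x)\<bar>)"
    by (rule order_trans[OF sum_abs], rule sum_mono, rule sum_abs)
  also have "\<dots> \<le> (\<Sum>i\<in>(UNIV::'d set). \<Sum>j\<in>(UNIV::'d set). norm v * norm v * (C * norm v powr \<alpha>))"
  proof (intro sum_mono, unfold abs_mult, intro mult_mono)
    fix i j
    have x: "x \<in> W" using inW[of 0] by simp
    have "\<bar>partial j (partial i f) (x + t *\<^sub>R v) - partial j (partial i f) x\<bar>
        \<le> C * norm (x + t *\<^sub>R v - x) powr \<alpha>"
      using t by (intro Hoelder inW x) auto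
    also have "\<dots> \<le> C * norm v powr \<alpha>"
      using t C \<alpha> by (intro mult_left_mono powr_mono2) (auto intro: mult_left_le_one_le)
    finally show "\<bar>partial j (partial i f) (x + t *\<^sub>R v) - partial j (partial i f) x\<bar> \<le> C * norm v powr \<alpha>" .
  qed (auto simp: component_le_norm_cart)
  also have "\<dots> = C * (real CARD('d))\<^sup>2 * norm v powr (2 + \<alpha>)"
    using False by (simp add: powr_add power2_eq_square)
  finally have "\<bar>(H t - H 0) / 2\<bar> \<le> C * (real CARD('d))\<^sup>2 / 2 * norm v powr (2 + \<alpha>)" by simp
  then show ?thesis unfolding eq' H0[symmetric] by (simp add: diff_divide_distrib)
qed simp

lemma C1_on_locally_Lipschitz_at:
  fixes f :: "real^'d::finite \<Rightarrow> real"
  assumes f: "C1_on W f" and W: "open W" and x: "x \<in> W"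
  obtains r L where "0 < r" "r \<le> 1" "cball x r \<subseteq> W" "0 \<le> L"
    "\<And>y. y \<in> cball x r \<Longrightarrow> \<bar>f y - f x\<bar> \<le> L * norm (y - x)"
proof -
  define D where "D v = (\<Sum>i\<in>UNIV. v $ i * partial i f x)" for v
  have "(f has_derivative D) (at x)"
    unfolding D_def[abs_def] by (rule C1_on_has_derivative[OF f W x])
  then have D: "bounded_linear D"
    and "\<forall>e>0. \<exists>d>0. \<forall>y. norm (y - x) < d \<longrightarrow> norm (f y - f x - D (y - x)) \<le> e * norm (y - x)"
    by (simp_all add: has_derivative_at_alt)
  then obtain d where d: "d > 0" "\<And>y. norm (y - x) < d \<Longrightarrow> norm (f y - f x - D (y - x)) \<le> 1 * norm (y - x)"
    using zero_less_one by blast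
  obtain B where B: "B \<ge> 0" "\<And>v. norm (D v) \<le> norm v * B"
    using bounded_linear.nonneg_bounded[OF D] by blast
  obtain s where s: "s > 0" "cball x s \<subseteq> W" using W x open_contains_cball by blast
  define r where "r = min (min s (d / 2)) 1"
  show ?thesis
  proof (rule that[of r "B + 1"])
    show "0 < r" "r \<le> 1" using s d by (auto simp: r_def)
    show "cball x r \<subseteq> W" using s(2) by (auto simp: r_def)
    fix y assume "y \<in> cball x r"
    then have "norm (y - x) \<le> r" by (simp add: dist_norm norm_minus_commute)
    then have "norm (y - x) < d" using d(1) by (simp add: r_def)
    from d(2)[OF this] B(2)[of "y - x"] show "\<bar>f y - f x\<bar> \<le> (B + 1) * norm (y - x)"
      by (simp add: algebra_simps abs_le_iff)
  qed (use B in simp)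
qed

section \<open>Smoothing the intensity at a small bandwidth\<close>

lemma integral_abs_le_kernel:
  fixes q k :: "'a::euclidean_space \<Rightarrow> real"
  assumes k: "integrable lborel k" "\<And>x. 0 \<le> k x" "\<And>x. norm x > 1 \<Longrightarrow> k x = 0"
    and q: "\<And>x. norm x \<le> 1 \<Longrightarrow> \<bar>q x\<bar> \<le> B" and int: "integrable lborel (\<lambda>x. q x * k x)"
  shows "\<bar>\<integral>x. q x * k x \<partial>lborel\<bar> \<le> B * (\<integral>x. k x \<partial>lborel)"
proof -
  have "\<bar>\<integral>x. q x * k x \<partial>lborel\<bar> \<le> (\<integral>x. \<bar>q x * k x\<bar> \<partial>lborel)"
    by (rule integral_abs_bound)
  also have "\<dots> \<le> (\<integral>x. B * k x \<partial>lborel)"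
  proof (rule integral_mono)
    show "\<bar>q x * k x\<bar> \<le> B * k x" for x
      using k q[of x] by (cases "norm x \<le> 1") (auto simp: abs_mult intro: mult_right_mono)
  qed (use k int in auto)
  finally show ?thesis by simp
qed

lemma nn_integral_lborel_affine:
  fixes f :: "'a::euclidean_space \<Rightarrow> ennreal"
  assumes "f \<in> borel_measurable borel" "c \<noteq> 0"
  shows "(\<integral>\<^sup>+ y. f y \<partial>lborel) = ennreal (\<bar>c\<bar> ^ DIM('a)) * (\<integral>\<^sup>+ u. f (t + c *\<^sub>R u) \<partial>lborel)"
  using assms
  by (subst lborel_affine[OF assms(2), of t])
     (simp add: nn_integral_density nn_integral_distr nn_integral_cmult)

text \<open>
  Substitution \<open>y = x0 - h u\<close>. The indicator of \<open>W\<close> extends \<open>lam\<close> by zero, since nothing is known about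
  \<open>lam\<close> outside \<open>W\<close>.
\<close>

lemma nn_integral_rescaled_kernel:
  fixes k :: "real^'d::finite \<Rightarrow> real"
  assumes k: "k \<in> borel_measurable borel" "\<And>u. 0 \<le> k u" 
    and lam: "lam \<in> borel_measurable (restrict_space borel W)" "\<And>u. u \<in> W \<Longrightarrow> 0 \<le> lam u"
    and W: "W \<in> sets borel" and h: "h > 0"
    and int: "integrable lborel (\<lambda>u. indicator W (x0 - h *\<^sub>R u) * lam (x0 - h *\<^sub>R u) * k u)"
  shows "(\<integral>\<^sup>+ y\<in>W. ennreal (k ((1 / h) *\<^sub>R (x0 - y)) * lam y) \<partial>lborel)
    = ennreal (h ^ CARD('d) * (\<integral>u. indicator W (x0 - h *\<^sub>R u) * lam (x0 - h *\<^sub>R u) * k u \<partial>lborel))"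
proof -
  have [measurable]: "(\<lambda>y. indicator W y * lam y) \<in> borel_measurable borel"
    using lam(1) W by (subst (asm) borel_measurable_restrict_space_iff) auto
  note [measurable] = k(1)
  let ?F = "\<lambda>y. ennreal (indicator W y * lam y * k ((1 / h) *\<^sub>R (x0 - y)))"
  have "(\<integral>\<^sup>+ y\<in>W. ennreal (k ((1 / h) *\<^sub>R (x0 - y)) * lam y) \<partial>lborel) = (\<integral>\<^sup>+ y. ?F y \<partial>lborel)"
    by (intro nn_integral_cong) (auto simp: indicator_def mult.commute)
  also have "\<dots> = ennreal (\<bar>- h\<bar> ^ DIM(real^'d)) * (\<integral>\<^sup>+ u. ?F (x0 + (- h) *\<^sub>R u) \<partial>lborel)"
    using h by (intro nn_integral_lborel_affine) auto
  also have "(\<integral>\<^sup>+ u. ?F (x0 + (- h) *\<^sub>R u) \<partial>lborel) =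
      (\<integral>\<^sup>+ u. ennreal (indicator W (x0 - h *\<^sub>R u) * lam (x0 - h *\<^sub>R u) * k u) \<partial>lborel)"
    using h by (intro nn_integral_cong) simp
  also have "\<dots> = ennreal (\<integral>u. indicator W (x0 - h *\<^sub>R u) * lam (x0 - h *\<^sub>R u) * k u \<partial>lborel)"
    using int lam(2) k(2) by (intro nn_integral_eq_integral) (auto simp: indicator_def)
  finally show ?thesis using h by (simp add: ennreal_mult')
qed

lemma rescaled_intensity_measurable:
  fixes lam :: "'a::euclidean_space \<Rightarrow> real"
  assumes "lam \<in> borel_measurable (restrict_space borel W)" "W \<in> sets borel"
  shows "(\<lambda>u. indicator W (x0 - t *\<^sub>R u) * lam (x0 - t *\<^sub>R u)) \<in> borel_measurable borel"
proof -
  have "(\<lambda>y. indicator W y * lam y) \<in> borel_measurable borel"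
    using assms by (subst (asm) borel_measurable_restrict_space_iff) auto
  from measurable_compose[OF _ this, of "\<lambda>u. x0 - t *\<^sub>R u" borel] show ?thesis by simp
qed

text \<open>
  For \<open>t \<le> r\<close> all arguments \<open>x0 - t u\<close> with \<open>u\<close> in the support of the kernel lie in \<open>W\<close>. There the
  intensity is its Taylor polynomial, whose integral is known, up to a remainder of order
  \<open>2 + \<alpha>\<close> in \<open>t\<close>.
\<close>

lemma beta_kernel_smoothing_bias:
  fixes lam :: "real^'d::finite \<Rightarrow> real" and x0 :: "real^'d"
  assumes \<gamma>: "\<gamma> \<ge> 0" and W: "open W" "cball x0 r \<subseteq> W" and C2: "C2_on W lam"
    and C: "C \<ge> 0" and \<alpha>: "\<alpha> > 0"
    and Hoelder: "\<And>i j x y. x \<in> W \<Longrightarrow> y \<in> W \<Longrightarrow>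
           \<bar>partial i (partial j lam) x - partial i (partial j lam) y\<bar> \<le> C * norm (x - y) powr \<alpha>"
    and t: "0 < t" "t \<le> r"
    and int: "integrable lborel (\<lambda>u. indicator W (x0 - t *\<^sub>R u) * lam (x0 - t *\<^sub>R u) * beta_kernel \<gamma> u)"
  shows "\<bar>(\<integral>u. indicator W (x0 - t *\<^sub>R u) * lam (x0 - t *\<^sub>R u) * beta_kernel \<gamma> u \<partial>lborel) - lam x0
      - t\<^sup>2 * (\<Sum>i\<in>UNIV. partial i (partial i lam) x0) / (2 * (real CARD('d) + 2 * \<gamma> + 2))\<bar>
    \<le> C * (real CARD('d))\<^sup>2 / 2 * t powr (2 + \<alpha>)"
proof -
  define q where "q u = indicator W (x0 - t *\<^sub>R u) * lam (x0 - t *\<^sub>R u)" for u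
  define b where "b i = - t * partial i lam x0" for i
  define H where "H i j = t\<^sup>2 * partial j (partial i lam) x0 / 2" for i j
  \<comment> \<open>The second order Taylor polynomial of \<open>lam\<close> at \<open>x0\<close>, as a function of the rescaled variable.\<close>
  define P where "P u = lam x0 + (\<Sum>i\<in>UNIV. b i * u $ i) + (\<Sum>i\<in>UNIV. \<Sum>j\<in>UNIV. H i j * (u $ i * u $ j))"
    for u :: "real^'d"
  note P = beta_kernel_quadratic_integral[OF \<gamma>, of "lam x0" b H, folded P_def]
  have int': "integrable lborel (\<lambda>u. q u * beta_kernel \<gamma> u)" using int by (simp add: q_def)
  have int_diff: "integrable lborel (\<lambda>u. (q u - P u) * beta_kernel \<gamma> u)"
    using int' P(1) by (simp add: left_diff_distrib)
  have int1: "integrable lborel (\<lambda>u::real^'d. beta_kernel \<gamma> u)"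
    using integrable_beta_kernel_times[OF \<gamma>, of "\<lambda>_. 1" 1] by simp
  have remainder: "\<bar>q u - P u\<bar> \<le> C * (real CARD('d))\<^sup>2 / 2 * t powr (2 + \<alpha>)" if u: "norm u \<le> 1" for u
  proof -
    have v: "norm (- t *\<^sub>R u) \<le> t" using u t by (simp add: mult_left_le)
    then have "x0 + - t *\<^sub>R u \<in> cball x0 r" using order_trans[OF v t(2)] by (simp add: dist_norm)
    then have "x0 + - t *\<^sub>R u \<in> W" using W(2) by blast
    then have "q u = lam (x0 + - t *\<^sub>R u)" by (simp add: q_def)
    moreover have "P u = lam x0 + (\<Sum>i\<in>UNIV. (- t *\<^sub>R u) $ i * partial i lam x0)
        + (\<Sum>i\<in>UNIV. \<Sum>j\<in>UNIV. (- t *\<^sub>R u) $ i * (- t *\<^sub>R u) $ j * partial j (partial i lam) x0) / 2"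
      by (simp add: P_def b_def H_def sum_divide_distrib power2_eq_square mult_ac)
    ultimately have "\<bar>q u - P u\<bar> \<le> C * (real CARD('d))\<^sup>2 / 2 * norm (- t *\<^sub>R u) powr (2 + \<alpha>)"
      using C2_on_Taylor[OF C2 W C \<alpha> Hoelder order_trans[OF v t(2)]] by (simp add: algebra_simps)
    also have "\<dots> \<le> C * (real CARD('d))\<^sup>2 / 2 * t powr (2 + \<alpha>)"
      using v C \<alpha> by (intro mult_left_mono powr_mono2) auto
    finally show ?thesis .
  qed
  have "(\<integral>u. q u * beta_kernel \<gamma> u \<partial>lborel) - (lam x0 + (\<Sum>i\<in>UNIV. H i i) / (real CARD('d) + 2 * \<gamma> + 2))
      = (\<integral>u. (q u - P u) * beta_kernel \<gamma> u \<partial>lborel)"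
    using int' P by (simp add: left_diff_distrib)
  also have "\<bar>\<dots>\<bar> \<le> C * (real CARD('d))\<^sup>2 / 2 * t powr (2 + \<alpha>) * (\<integral>u. beta_kernel \<gamma> (u::real^'d) \<partial>lborel)"
    by (rule integral_abs_le_kernel[OF int1 beta_kernel_nonneg[OF \<gamma>] beta_kernel_outside remainder int_diff])
  finally have *: "\<bar>(\<integral>u. q u * beta_kernel \<gamma> u \<partial>lborel)
      - (lam x0 + (\<Sum>i\<in>UNIV. H i i) / (real CARD('d) + 2 * \<gamma> + 2))\<bar>
    \<le> C * (real CARD('d))\<^sup>2 / 2 * t powr (2 + \<alpha>)"
    by (simp add: beta_kernel_integral[OF \<gamma>])
  have "(\<Sum>i\<in>UNIV. H i i) / (real CARD('d) + 2 * \<gamma> + 2) =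
      t\<^sup>2 * (\<Sum>i\<in>UNIV. partial i (partial i lam) x0) / (2 * (real CARD('d) + 2 * \<gamma> + 2))"
    by (simp add: H_def flip: sum_divide_distrib sum_distrib_left)
  with * show ?thesis by (simp add: q_def diff_diff_eq)
qed

text \<open>
  Replacing \<open>lam (x0 - t u)\<close> by \<open>lam x0\<close> costs at most \<open>L t\<close> on the support of the kernel.
\<close>

lemma beta_kernel_smoothing_square:
  fixes lam :: "real^'d::finite \<Rightarrow> real" and x0 :: "real^'d"
  assumes \<gamma>: "\<gamma> \<ge> 0" and W: "cball x0 r \<subseteq> W" and t: "0 < t" "t \<le> r"
    and L: "L \<ge> 0" "\<And>y. y \<in> cball x0 r \<Longrightarrow> \<bar>lam y - lam x0\<bar> \<le> L * norm (y - x0)"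
    and int: "integrable lborel (\<lambda>u. indicator W (x0 - t *\<^sub>R u) * lam (x0 - t *\<^sub>R u) * (beta_kernel \<gamma> u)\<^sup>2)"
  shows "\<bar>(\<integral>u. indicator W (x0 - t *\<^sub>R u) * lam (x0 - t *\<^sub>R u) * (beta_kernel \<gamma> u)\<^sup>2 \<partial>lborel)
      - lam x0 * beta_Q TYPE('d) \<gamma>\<bar> \<le> L * t * beta_Q TYPE('d) \<gamma>"
proof -
  define q where "q u = indicator W (x0 - t *\<^sub>R u) * lam (x0 - t *\<^sub>R u)" for u
  have int': "integrable lborel (\<lambda>u. q u * (beta_kernel \<gamma> u)\<^sup>2)" using int by (simp add: q_def)
  have int1: "integrable lborel (\<lambda>u::real^'d. (beta_kernel \<gamma> u)\<^sup>2)"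
    using integrable_beta_kernel_square_times[OF \<gamma>, of "\<lambda>_. 1" 1] by simp
  have close: "\<bar>q u - lam x0\<bar> \<le> L * t" if u: "norm u \<le> 1" for u
  proof -
    have v: "norm (t *\<^sub>R u) \<le> t" using u t by (simp add: mult_left_le)
    then have y: "x0 - t *\<^sub>R u \<in> cball x0 r" using order_trans[OF v t(2)] by (simp add: dist_norm)
    then have "x0 - t *\<^sub>R u \<in> W" using W by blast
    then have "\<bar>q u - lam x0\<bar> \<le> L * norm (x0 - t *\<^sub>R u - x0)" using L(2)[OF y] by (simp add: q_def)
    also have "\<dots> \<le> L * t" using v L(1) by (intro mult_left_mono) auto
    finally show ?thesis .
  qed
  have int_diff: "integrable lborel (\<lambda>u. (q u - lam x0) * (beta_kernel \<gamma> u)\<^sup>2)"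
    using int' int1 by (simp add: left_diff_distrib)
  have "(\<integral>u. q u * (beta_kernel \<gamma> u)\<^sup>2 \<partial>lborel) - lam x0 * beta_Q TYPE('d) \<gamma>
      = (\<integral>u. (q u - lam x0) * (beta_kernel \<gamma> u)\<^sup>2 \<partial>lborel)"
    using int' int1 by (simp add: left_diff_distrib beta_Q_def)
  also have "\<bar>\<dots>\<bar> \<le> L * t * (\<integral>u. (beta_kernel \<gamma> (u::real^'d))\<^sup>2 \<partial>lborel)"
    by (rule integral_abs_le_kernel[OF int1 _ _ close int_diff]) (auto simp: beta_kernel_outside)
  finally show ?thesis by (simp add: q_def beta_Q_def)
qed

section \<open>Bias and variance of the estimator\<close>

theorem theorem1:
  fixes M :: "'w measure"
    and \<Phi> :: "nat \<Rightarrow> 'w \<Rightarrow> real^'d::finite \<Rightarrow> nat"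
    and W :: "(real^'d) set"
    and lam :: "real^'d \<Rightarrow> real"
    and g :: "(real^'d) \<times> (real^'d) \<Rightarrow> real"
    and h :: "nat \<Rightarrow> real"
    and \<gamma> \<alpha> C :: real
    and x0 :: "real^'d"
  assumes "prob_space M"
    and "open W" and "bounded W" and "W \<noteq> {}"
    and "iid_point_processes M \<Phi> {1..}"
    and "locally_finite_factorial_moments M (\<Phi> 1)"
    and "intensity_on M (\<Phi> 1) W lam"
    and "pair_correlation_on M (\<Phi> 1) W lam g"
    and "bounded (g ` (W \<times> W))"
    and "\<And>x. x \<in> W \<Longrightarrow> lam x > 0"
    and "C2_on W lam"
    and "\<alpha> > 0" and "C > 0"
    and "\<And>i j x y. x \<in> W \<Longrightarrow> y \<in> W \<Longrightarrow>
           \<bar>partial i (partial j lam) x - partial i (partial j lam) y\<bar> \<le> C * norm (x - y) powr \<alpha>"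
    and "\<gamma> \<ge> 0"
    and "\<And>n. n \<ge> 1 \<Longrightarrow> h n > 0"
    and "h \<longlonglongrightarrow> 0"
    and "filterlim (\<lambda>n. real n * h n ^ CARD('d)) at_top sequentially"
    and "x0 \<in> W"
  shows "(\<lambda>n. (prob_space.expectation M (intensity_estimator \<Phi> W \<gamma> h x0 n) - lam x0) -
              (h n)\<^sup>2 * (\<Sum>i\<in>UNIV. partial i (partial i lam) x0) /
                (2 * (real CARD('d) + 2 * \<gamma> + 2)))
           \<in> O[sequentially](\<lambda>n. h n powr (2 + \<alpha>)) \<and>
         (\<lambda>n. prob_space.variance M (intensity_estimator \<Phi> W \<gamma> h x0 n) -
              lam x0 * beta_Q TYPE('d) \<gamma> / (real n * h n ^ CARD('d)))
           \<in> O[sequentially](\<lambda>n. 1 / (real n * h n ^ (CARD('d) - 1)))"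
proof -
  interpret prob_space M by fact
  note W = \<open>open W\<close> \<open>bounded W\<close> and C2 = \<open>C2_on W lam\<close> and \<gamma> = \<open>\<gamma> \<ge> 0\<close>
    and pos = \<open>\<And>x. x \<in> W \<Longrightarrow> lam x > 0\<close> and intens = \<open>intensity_on M (\<Phi> 1) W lam\<close>
  have lam_meas: "lam \<in> borel_measurable (restrict_space borel W)"
    using intens by (simp add: intensity_on_def)
  have lam_nonneg: "0 \<le> lam u" if "u \<in> W" for u using pos[OF that] by simp
  have W_sets: "W \<in> sets borel" using W(1) by simp
  obtain rho K where rho: "product_density_on M (\<Phi> 1) W rho" and K: "K \<ge> 0"
    "\<And>u v. u \<in> W \<Longrightarrow> v \<in> W \<Longrightarrow> rho (u, v) \<le> K * (lam u * lam v)"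
    using product_density_le_of_bounded_pair_correlation[OF \<open>pair_correlation_on M (\<Phi> 1) W lam g\<close>
        \<open>bounded (g ` (W \<times> W))\<close> pos] by blast
  have "C1_on W lam" using C2 by (simp add: C2_on_def)
  then obtain r L where r: "0 < r" "r \<le> 1" "cball x0 r \<subseteq> W"
    and L: "0 \<le> L" "\<And>y. y \<in> cball x0 r \<Longrightarrow> \<bar>lam y - lam x0\<bar> \<le> L * norm (y - x0)"
    using C1_on_locally_Lipschitz_at W(1) \<open>x0 \<in> W\<close> by blast
  \<comment> \<open>As \<open>r \<le> 1\<close>, this bounds the intensity on the ball of radius \<open>r\<close> around \<open>x0\<close>.\<close>
  define B where "B = lam x0 + L"
  define q where "q t u = indicator W (x0 - t *\<^sub>R u) * lam (x0 - t *\<^sub>R u)" for t u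
  \<comment> \<open>Up to powers of \<open>t\<close>, these are the mean of a point sum and the main part of its variance.\<close>
  define a where "a t = (\<integral>u. q t u * beta_kernel \<gamma> u \<partial>lborel)" for t
  define b where "b t = (\<integral>u. q t u * (beta_kernel \<gamma> u)\<^sup>2 \<partial>lborel)" for t
  have q_nonneg: "0 \<le> q t u" for t u using lam_nonneg by (simp add: q_def indicator_def)
  have q_meas: "q t \<in> borel_measurable borel" for t
    unfolding q_def[abs_def] by (rule rescaled_intensity_measurable[OF lam_meas W_sets])
  have q_bound: "\<bar>q t u\<bar> \<le> B" if "0 < t" "t \<le> r" "norm u \<le> 1" for t u
  proof -
    have v: "norm (t *\<^sub>R u) \<le> t" using that by (simp add: mult_left_le)
    then have y: "x0 - t *\<^sub>R u \<in> cball x0 r" using order_trans[OF v that(2)] by (simp add: dist_norm)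
    have "norm (t *\<^sub>R u) \<le> 1" using v that r(2) by linarith
    then have "L * norm (t *\<^sub>R u) \<le> L * 1" using L(1) by (rule mult_left_mono)
    then have "lam (x0 - t *\<^sub>R u) \<le> B" using L(2)[OF y] by (simp add: B_def)
    moreover have "x0 - t *\<^sub>R u \<in> W" using y r(3) by blast
    ultimately show ?thesis using lam_nonneg by (simp add: q_def)
  qed
  have int_a: "integrable lborel (\<lambda>u. q t u * beta_kernel \<gamma> u)"
    and int_b: "integrable lborel (\<lambda>u. q t u * (beta_kernel \<gamma> u)\<^sup>2)" if "0 < t" "t \<le> r" for t
    using integrable_beta_kernel_times[OF \<gamma> q_meas q_bound[OF that]]
      integrable_beta_kernel_square_times[OF \<gamma> q_meas q_bound[OF that]] by auto
  have a_nonneg: "0 \<le> a t" and b_nonneg: "0 \<le> b t" for t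
    unfolding a_def b_def
    by (intro Bochner_Integration.integral_nonneg mult_nonneg_nonneg q_nonneg
        beta_kernel_nonneg[OF \<gamma>] zero_le_power2)+
  have a_le: "a t \<le> B" if t: "0 < t" "t \<le> r" for t
  proof -
    have int1: "integrable lborel (\<lambda>u::real^'d. beta_kernel \<gamma> u)"
      using integrable_beta_kernel_times[OF \<gamma>, of "\<lambda>_. 1" 1] by simp
    have "\<bar>a t\<bar> \<le> B * (\<integral>u. beta_kernel \<gamma> (u::real^'d) \<partial>lborel)"
      unfolding a_def
      by (rule integral_abs_le_kernel[OF int1 beta_kernel_nonneg[OF \<gamma>] beta_kernel_outside q_bound[OF t] int_a[OF t]])
    then show ?thesis by (simp add: beta_kernel_integral[OF \<gamma>])
  qed
  have bias: "\<bar>a t - lam x0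
      - t\<^sup>2 * (\<Sum>i\<in>UNIV. partial i (partial i lam) x0) / (2 * (real CARD('d) + 2 * \<gamma> + 2))\<bar>
    \<le> C * (real CARD('d))\<^sup>2 / 2 * t powr (2 + \<alpha>)" if t: "0 < t" "t \<le> r" for t
    unfolding a_def q_def using \<open>C > 0\<close> int_a[OF t]
    by (intro beta_kernel_smoothing_bias[OF \<gamma> W(1) r(3) C2 _ \<open>\<alpha> > 0\<close> _ t]) (auto simp: q_def intro: assms(14))
  have square: "\<bar>b t - lam x0 * beta_Q TYPE('d) \<gamma>\<bar> \<le> L * t * beta_Q TYPE('d) \<gamma>" if t: "0 < t" "t \<le> r" for t
    unfolding b_def q_def
    by (rule beta_kernel_smoothing_square[OF \<gamma> r(3) t L int_b[OF t, unfolded q_def]])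
  have moments: "expectation (intensity_estimator \<Phi> W \<gamma> h x0 n) = a (h n)"
      "\<bar>variance (intensity_estimator \<Phi> W \<gamma> h x0 n) - b (h n) / (real n * h n ^ CARD('d))\<bar>
        \<le> (K + 1) * (a (h n))\<^sup>2 / real n"
    if n: "n \<ge> 1" "h n \<le> r" for n
  proof -
    define t where "t = h n"
    define N where "N = real n"
    define s where "s = t ^ CARD('d)"
    have t: "0 < t" "t \<le> r" using assms(16)[OF n(1)] n(2) by (auto simp: t_def)
    have Ns: "N > 0" "s > 0" using n(1) t by (auto simp: N_def s_def)
    define f where "f y = beta_kernel \<gamma> ((1 / t) *\<^sub>R (x0 - y))" for y
    have f: "f \<in> borel_measurable borel" "\<And>y. 0 \<le> f y"
      by (simp_all add: f_def[abs_def] beta_kernel_nonneg[OF \<gamma>])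
    have T: "intensity_estimator \<Phi> W \<gamma> h x0 n = (\<lambda>\<omega>. 1 / (N * s) * (\<Sum>i=1..n. point_sum (\<Phi> i \<omega>) W f))"
      by (simp add: fun_eq_iff intensity_estimator_def f_def[abs_def] t_def N_def s_def)
    have A: "(\<integral>\<^sup>+ u\<in>W. ennreal (f u * lam u) \<partial>lborel) = ennreal (s * a t)"
      unfolding f_def a_def q_def s_def
      by (rule nn_integral_rescaled_kernel[OF _ beta_kernel_nonneg[OF \<gamma>] lam_meas lam_nonneg W_sets t(1)
            int_a[OF t, unfolded q_def]]) simp_all
    have Bb: "(\<integral>\<^sup>+ u\<in>W. ennreal ((f u)\<^sup>2 * lam u) \<partial>lborel) = ennreal (s * b t)"
      unfolding f_def b_def q_def s_def
      by (rule nn_integral_rescaled_kernel[where k = "\<lambda>u. (beta_kernel \<gamma> u)\<^sup>2",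
            OF _ _ lam_meas lam_nonneg W_sets t(1) int_b[OF t, unfolded q_def]]) simp_all
    have nonneg: "0 \<le> s * a t" "0 \<le> s * b t" using Ns a_nonneg b_nonneg by simp_all
    note mom = iid_point_sum_moments[OF \<open>prob_space M\<close> \<open>iid_point_processes M \<Phi> {1..}\<close> W intens rho K f
        A nonneg(1) Bb nonneg(2), where n = n and c = "1 / (N * s)"]
    have mean: "expectation (intensity_estimator \<Phi> W \<gamma> h x0 n) = 1 / (N * s) * (real n * (s * a t))"
      unfolding T by (rule mom(1))
    have var: "\<bar>variance (intensity_estimator \<Phi> W \<gamma> h x0 n) - (1 / (N * s))\<^sup>2 * (real n * (s * b t))\<bar>
        \<le> (1 / (N * s))\<^sup>2 * (real n * ((K + 1) * (s * a t)\<^sup>2))"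
      unfolding T by (rule mom(2))
    show "expectation (intensity_estimator \<Phi> W \<gamma> h x0 n) = a (h n)"
      using mean Ns by (simp add: t_def N_def)
    have "(1 / (N * s))\<^sup>2 * (N * (s * b t)) = b t / (N * s)"
      "(1 / (N * s))\<^sup>2 * (N * ((K + 1) * (s * a t)\<^sup>2)) = (K + 1) * (a t)\<^sup>2 / N"
      using Ns by (simp_all add: power2_eq_square field_simps)
    note var[folded N_def, unfolded this]
    then show "\<bar>variance (intensity_estimator \<Phi> W \<gamma> h x0 n) - b (h n) / (real n * h n ^ CARD('d))\<bar>
        \<le> (K + 1) * (a (h n))\<^sup>2 / real n"
      unfolding t_def N_def s_def .
  qed
  have "eventually (\<lambda>n. h n < r) sequentially" using order_tendstoD(2)[OF \<open>h \<longlonglongrightarrow> 0\<close> r(1)] .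
  then have ev: "eventually (\<lambda>n. n \<ge> 1 \<and> h n \<le> r) sequentially"
    using eventually_ge_at_top[of 1] by eventually_elim auto
  have Q_nonneg: "0 \<le> beta_Q TYPE('d) \<gamma>" by (simp add: beta_Q_def)
  show ?thesis
  proof (intro conjI)
    show "(\<lambda>n. (expectation (intensity_estimator \<Phi> W \<gamma> h x0 n) - lam x0) -
              (h n)\<^sup>2 * (\<Sum>i\<in>UNIV. partial i (partial i lam) x0) / (2 * (real CARD('d) + 2 * \<gamma> + 2)))
           \<in> O[sequentially](\<lambda>n. h n powr (2 + \<alpha>))"
    proof (rule bigoI[where c = "C * (real CARD('d))\<^sup>2 / 2"])
      show "eventually (\<lambda>n. norm ((expectation (intensity_estimator \<Phi> W \<gamma> h x0 n) - lam x0) -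
              (h n)\<^sup>2 * (\<Sum>i\<in>UNIV. partial i (partial i lam) x0) / (2 * (real CARD('d) + 2 * \<gamma> + 2)))
          \<le> C * (real CARD('d))\<^sup>2 / 2 * norm (h n powr (2 + \<alpha>))) sequentially"
        using ev
      proof eventually_elim
        case (elim n)
        have "h n > 0" "h n \<le> r" using assms(16)[of n] elim by auto
        from bias[OF this] show ?case using elim by (simp add: moments)
      qed
    qed
    show "(\<lambda>n. variance (intensity_estimator \<Phi> W \<gamma> h x0 n) -
              lam x0 * beta_Q TYPE('d) \<gamma> / (real n * h n ^ CARD('d)))
           \<in> O[sequentially](\<lambda>n. 1 / (real n * h n ^ (CARD('d) - 1)))"
    proof (rule bigoI[where c = "(K + 1) * B\<^sup>2 + L * beta_Q TYPE('d) \<gamma>"])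
      show "eventually (\<lambda>n. norm (variance (intensity_estimator \<Phi> W \<gamma> h x0 n) -
              lam x0 * beta_Q TYPE('d) \<gamma> / (real n * h n ^ CARD('d)))
          \<le> ((K + 1) * B\<^sup>2 + L * beta_Q TYPE('d) \<gamma>) * norm (1 / (real n * h n ^ (CARD('d) - 1)))) sequentially"
        using ev
      proof eventually_elim
        case (elim n)
        define t where "t = h n"
        define N where "N = real n"
        define s where "s = t ^ (CARD('d) - 1)"
        define V where "V = variance (intensity_estimator \<Phi> W \<gamma> h x0 n)"
        have t: "0 < t" "t \<le> r" using assms(16)[of n] elim by (auto simp: t_def)
        have s: "0 < s" "s \<le> 1" using t r(2) by (auto simp: s_def intro: power_le_one)
        have N: "N > 0" using elim by (simp add: N_def)
        \<comment> \<open>The dimension is at least \<open>1\<close>, so a factor \<open>t\<close> can be split off.\<close>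
        have split: "t ^ CARD('d) = t * s"
          unfolding s_def by (simp flip: power_Suc)
        have var: "\<bar>V - b t / (N * (t * s))\<bar> \<le> (K + 1) * (a t)\<^sup>2 / N"
          using moments(2)[of n] elim unfolding V_def t_def[symmetric] N_def[symmetric] split by simp
        have "(K + 1) * (a t)\<^sup>2 / N \<le> (K + 1) * B\<^sup>2 / N"
          using a_le[OF t] a_nonneg K(1) N by (intro divide_right_mono mult_left_mono power_mono) auto
        \<comment> \<open>As \<open>s \<le> 1\<close>, the error of order \<open>1 / n\<close> is absorbed in the claimed one.\<close>
        also have "\<dots> \<le> (K + 1) * B\<^sup>2 / (N * s)"
          using N s K(1) by (intro divide_left_mono) (auto simp: mult_left_le)
        finally have 1: "(K + 1) * (a t)\<^sup>2 / N \<le> (K + 1) * B\<^sup>2 / (N * s)" .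
        have "\<bar>b t / (N * (t * s)) - lam x0 * beta_Q TYPE('d) \<gamma> / (N * (t * s))\<bar>
            = \<bar>b t - lam x0 * beta_Q TYPE('d) \<gamma>\<bar> / (N * (t * s))"
          using N t s by (simp flip: diff_divide_distrib)
        also have "\<dots> \<le> L * t * beta_Q TYPE('d) \<gamma> / (N * (t * s))"
          using square[OF t] N t s by (intro divide_right_mono) auto
        also have "\<dots> = L * beta_Q TYPE('d) \<gamma> / (N * s)" using t by simp
        finally have 2: "\<bar>b t / (N * (t * s)) - lam x0 * beta_Q TYPE('d) \<gamma> / (N * (t * s))\<bar>
            \<le> L * beta_Q TYPE('d) \<gamma> / (N * s)" .
        have "\<bar>V - lam x0 * beta_Q TYPE('d) \<gamma> / (N * (t * s))\<bar>
            \<le> (K + 1) * B\<^sup>2 / (N * s) + L * beta_Q TYPE('d) \<gamma> / (N * s)"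
        proof -
          have "\<bar>V - q\<bar> \<le> d + e" if "\<bar>V - p\<bar> \<le> c" "c \<le> d" "\<bar>p - q\<bar> \<le> e" for p q c d e
            using that by linarith
          from this[OF var 1 2] show ?thesis .
        qed
        also have "\<dots> = ((K + 1) * B\<^sup>2 + L * beta_Q TYPE('d) \<gamma>) * norm (1 / (N * s))"
          using N s by (simp add: add_divide_distrib)
        finally show ?case
          unfolding V_def s_def[symmetric] t_def[symmetric] N_def[symmetric] split[symmetric]
          by (simp add: s_def)
      qed
    qed
  qed
qed

end
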